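(* Let $\varepsilon\in\{1,-1\}$ and let $n$ be an integer with $n\ge 6$ if $\varepsilon=1$ and $n\ge 7$ if $\varepsilon=-1$. Let $\Theta$ be a connected graph such that for every vertex $v$ of $\Theta$ the subgraph induced on the set of neighbours of $v$ is isomorphic to $\Sigma^\varepsilon_n$. Then $\Theta\cong\Sigma^\varepsilon_{n+1}$.
   Context: Graphs are undirected, without loops or multiple edges. For $m\ge 1$ and $\varepsilon\in\{1,-1\}$, let $T_m$ be an $m$-dimensional vector space over $\mathrm{GF}(3)$ carrying a nondegenerate symmetric bilinear form $(\cdot,\cdot)$ whose discriminant is $\varepsilon$ (modulo squares). A point $\langle v\rangle$ of $T_m$ is of type $(+)$ if $(v,v)=1$. The graph $\Sigma^\varepsilon_m$ has as vertices the $(+)$-points of $T_m$, two vertices being adjacent iff they are perpendicular with respect to the form. *)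

theory Defs
  imports Main "Jordan_Normal_Form.Determinant"
begin

(* GF(3) is modelled by the residues {0,1,2} of int, arithmetic mod 3.
   T_m is modelled as GF(3)^m: functions nat => int with values in {0,1,2}
   on {0..<m} and 0 outside. A symmetric bilinear form on T_m is given by its
   Gram matrix A (entries taken mod 3). *)

definition vecs3 :: "nat \<Rightarrow> (nat \<Rightarrow> int) set" where
  "vecs3 m = {v. (\<forall>i<m. v i \<in> {0,1,2}) \<and> (\<forall>i\<ge>m. v i = 0)}"

definition form3 :: "nat \<Rightarrow> (nat \<Rightarrow> nat \<Rightarrow> int) \<Rightarrow> (nat \<Rightarrow> int) \<Rightarrow> (nat \<Rightarrow> int) \<Rightarrow> int" where
  "form3 m A u v = (\<Sum>i<m. \<Sum>j<m. A i j * u i * v j) mod 3"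

definition neg3 :: "(nat \<Rightarrow> int) \<Rightarrow> (nat \<Rightarrow> int)" where
  "neg3 v = (\<lambda>i. (- v i) mod 3)"

(* A is the Gram matrix of a nondegenerate symmetric bilinear form on GF(3)^m
   with discriminant eps modulo squares. The nonzero squares of GF(3) are {1},
   so this means det A = eps in GF(3) (which also gives nondegeneracy). *)
definition gram3 :: "nat \<Rightarrow> int \<Rightarrow> (nat \<Rightarrow> nat \<Rightarrow> int) \<Rightarrow> bool" where
  "gram3 m eps A \<longleftrightarrow>
     (\<forall>i<m. \<forall>j<m. A i j mod 3 = A j i mod 3) \<and>
     det (mat m m (\<lambda>(i,j). A i j)) mod 3 = eps mod 3"

(* The point <v> of T_m is represented by the set {v, -v} of its nonzero
   vectors. Vertices of Sigma: the (+)-points, i.e. (v,v) = 1. *)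
definition SigmaV :: "nat \<Rightarrow> (nat \<Rightarrow> nat \<Rightarrow> int) \<Rightarrow> (nat \<Rightarrow> int) set set" where
  "SigmaV m A = {{v, neg3 v} | v. v \<in> vecs3 m \<and> form3 m A v v = 1}"

definition SigmaE :: "nat \<Rightarrow> (nat \<Rightarrow> nat \<Rightarrow> int) \<Rightarrow> (nat \<Rightarrow> int) set \<Rightarrow> (nat \<Rightarrow> int) set \<Rightarrow> bool" where
  "SigmaE m A P Q \<longleftrightarrow> P \<in> SigmaV m A \<and> Q \<in> SigmaV m A \<and>
     (\<exists>u\<in>P. \<exists>v\<in>Q. form3 m A u v = 0)"

definition simple_graph :: "'a set \<Rightarrow> ('a \<Rightarrow> 'a \<Rightarrow> bool) \<Rightarrow> bool" where
  "simple_graph V E \<longleftrightarrow> (\<forall>u v. E u v \<longrightarrow> u \<in> V \<and> v \<in> V \<and> u \<noteq> v \<and> E v u)"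

definition connected_graph :: "'a set \<Rightarrow> ('a \<Rightarrow> 'a \<Rightarrow> bool) \<Rightarrow> bool" where
  "connected_graph V E \<longleftrightarrow> V \<noteq> {} \<and>
     (\<forall>u\<in>V. \<forall>v\<in>V. (\<lambda>x y. x \<in> V \<and> y \<in> V \<and> E x y)\<^sup>*\<^sup>* u v)"

definition graph_iso :: "'a set \<Rightarrow> ('a \<Rightarrow> 'a \<Rightarrow> bool) \<Rightarrow> 'b set \<Rightarrow> ('b \<Rightarrow> 'b \<Rightarrow> bool) \<Rightarrow> bool" where
  "graph_iso V1 E1 V2 E2 \<longleftrightarrow>
     (\<exists>f. bij_betw f V1 V2 \<and> (\<forall>u\<in>V1. \<forall>v\<in>V1. E1 u v \<longleftrightarrow> E2 (f u) (f v)))"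

definition nbhd :: "'a set \<Rightarrow> ('a \<Rightarrow> 'a \<Rightarrow> bool) \<Rightarrow> 'a \<Rightarrow> 'a set" where
  "nbhd V E v = {u \<in> V. E v u}"

definition induced :: "'a set \<Rightarrow> ('a \<Rightarrow> 'a \<Rightarrow> bool) \<Rightarrow> 'a \<Rightarrow> 'a \<Rightarrow> bool" where
  "induced W E = (\<lambda>x y. x \<in> W \<and> y \<in> W \<and> E x y)"

end

theory Submission
  imports Defs "HOL-Library.Function_Algebras"
begin

text \<open>
  Since 3x = 0, subspaces over GF(3) are additive subgroups, and a subgroup that is more than
  three times larger than its radical contains vectors of norm 1 and of norm -1.  This replaces
  dimension arguments by counting.

  A plus point on the line through two non-perpendicular plus points \<open>a\<close>, \<open>b\<close> is determined by
  the graph as a point perpendicular to all common neighbours of \<open>a\<close> and \<open>b\<close>.  Hence graph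
  automorphisms are induced by isometries, and two identifications of a graph with the graph of
  \<open>U\<close> that agree on \<open>e\<close> and on its neighbours differ at most by the reflection in \<open>e\<close>.

  Identify the neighbourhood of a vertex of \<open>\<Theta>\<close> with the graph of \<open>e\<close>-perp in \<open>T\<close>, of dimension
  \<open>n + 1\<close>.  At each \<open>x\<close> perpendicular to \<open>e\<close> this extends to a chart on \<open>x\<close>-perp in exactly two
  ways, which differ by the exchange of \<open>e + p\<close> and \<open>e - p\<close> for isotropic \<open>p\<close>.  Two charts at
  \<open>x\<close> and \<open>y\<close> either agree on all \<open>e + p\<close> or are exchanged on all of them.  As any three plus
  points perpendicular to \<open>e\<close> have a common perpendicular isotropic vector, agreement is
  transitive, so all charts can be chosen to agree.  They glue to a map on all plus points of
  \<open>T\<close>, and it is an isomorphism because \<open>e\<close> and any two plus points are perpendicular to a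
  common plus point.
\<close>

section \<open>The field of three elements and forms over it\<close>

text \<open>An explicit three-element type turns every identity in a few scalars into a finite case
  check.\<close>

datatype gf3 = Zero3 | One3 | Two3

instantiation gf3 :: field
begin

definition "0 = Zero3"
definition "1 = One3"

fun uminus_gf3 where
  "- Zero3 = Zero3" | "- One3 = Two3" | "- Two3 = One3"

fun plus_gf3 where
  "Zero3 + y = y"
| "One3 + Zero3 = One3" | "One3 + One3 = Two3" | "One3 + Two3 = Zero3"
| "Two3 + Zero3 = Two3" | "Two3 + One3 = Zero3" | "Two3 + Two3 = One3"

fun times_gf3 where
  "Zero3 * y = Zero3" | "One3 * y = y" | "Two3 * y = - y"

definition "x - y = x + - (y :: gf3)"
definition "inverse (x :: gf3) = x"
definition "x div y = x * (y :: gf3)"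

instance
proof
  fix a b c :: gf3
  show "a + b + c = a + (b + c)" by (cases a; cases b; cases c) auto
  show "a + b = b + a" by (cases a; cases b) auto
  show "0 + a = a" by (simp add: zero_gf3_def)
  show "- a + a = 0" by (cases a) (auto simp: zero_gf3_def)
  show "a - b = a + - b" by (simp add: minus_gf3_def)
  show "a * b * c = a * (b * c)" by (cases a; cases b; cases c) auto
  show "a * b = b * a" by (cases a; cases b) auto
  show "1 * a = a" by (simp add: one_gf3_def)
  show "(a + b) * c = a * c + b * c" by (cases a; cases b; cases c) auto
  show "(0::gf3) \<noteq> 1" by (simp add: zero_gf3_def one_gf3_def)
  show "a \<noteq> 0 \<Longrightarrow> inverse a * a = 1"
    by (cases a) (auto simp: zero_gf3_def one_gf3_def inverse_gf3_def)
  show "a div b = a * inverse b" by (simp add: divide_gf3_def inverse_gf3_def)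
  show "inverse (0::gf3) = 0" by (simp add: inverse_gf3_def)
qed

end

lemma gf3_exhaust [case_names 0 1 minus_1]:
  fixes c :: gf3
  obtains "c = 0" | "c = 1" | "c = - 1"
  by (cases c) (auto simp: zero_gf3_def one_gf3_def)

lemma gf3_numerals [simp]: "(2::gf3) = - 1" "(3::gf3) = 0" "(4::gf3) = 1"
proof -
  show 2: "(2::gf3) = - 1"
    unfolding one_add_one[symmetric] by (simp add: one_gf3_def)
  have "(3::gf3) = 2 + 1" "(4::gf3) = 2 + 2" by simp_all
  then show "(3::gf3) = 0" "(4::gf3) = 1" unfolding 2 by (simp_all add: one_gf3_def zero_gf3_def)
qed

lemma gf3_neq [simp]: "(1::gf3) \<noteq> - 1" "(- 1::gf3) \<noteq> 1"
  by (simp_all add: one_gf3_def)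

lemma gf3_self_cancel: "x = - x \<longleftrightarrow> (x::gf3) = 0" "- x = x \<longleftrightarrow> (x::gf3) = 0"
  by (cases x rule: gf3_exhaust; simp)+

lemma gf3_triple: "x + x + x = (0::gf3)"
  by (cases x rule: gf3_exhaust) simp_all

lemma gf3_add_self: "x + x = - (x::gf3)"
  by (cases x rule: gf3_exhaust) simp_all

lemma gf3_square: "(x::gf3) \<noteq> 0 \<Longrightarrow> x * x = 1"
  by (cases x rule: gf3_exhaust) simp_all

lemma UNIV_gf3: "(UNIV :: gf3 set) = {0, 1, - 1}"
  using gf3_exhaust by blast

instance gf3 :: finite
  by standard (simp add: UNIV_gf3)

lemma card_UNIV_gf3: "card (UNIV :: gf3 set) = 3"
  unfolding UNIV_gf3 by (simp add: card_insert_if)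

text \<open>Scalars act on any abelian group, without a module structure; additivity in the scalar
  needs 3x = 0 and comes with \<open>scl_add\<close>.\<close>

definition scl :: "gf3 \<Rightarrow> 'v::ab_group_add \<Rightarrow> 'v" where
  "scl c x = (if c = 0 then 0 else if c = 1 then x else - x)"

lemma scl_simps [simp]:
  "scl 0 x = 0" "scl 1 x = x" "scl (- 1) x = - x" "scl c 0 = 0"
  by (simp_all add: scl_def)

lemma scl_minus: "scl (- c) x = - scl c x"
  by (cases c rule: gf3_exhaust) simp_all

lemma scl_scl: "scl c (scl d x) = scl (c * d) x"
  by (cases c rule: gf3_exhaust; cases d rule: gf3_exhaust) simp_all

section \<open>Subgroups in the role of subspaces\<close>

definition sgrp :: "'v::ab_group_add set \<Rightarrow> bool" where
  "sgrp U \<longleftrightarrow> 0 \<in> U \<and> (\<forall>x\<in>U. \<forall>y\<in>U. x + y \<in> U) \<and> (\<forall>x\<in>U. - x \<in> U)"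

lemma sgrp_0: "sgrp U \<Longrightarrow> 0 \<in> U"
  and sgrp_add: "sgrp U \<Longrightarrow> x \<in> U \<Longrightarrow> y \<in> U \<Longrightarrow> x + y \<in> U"
  and sgrp_neg: "sgrp U \<Longrightarrow> x \<in> U \<Longrightarrow> - x \<in> U"
  by (simp_all add: sgrp_def)

lemma sgrp_neg_iff: "sgrp U \<Longrightarrow> - x \<in> U \<longleftrightarrow> x \<in> U"
  using sgrp_neg[of U x] sgrp_neg[of U "- x"] by auto

lemma sgrp_diff: "sgrp U \<Longrightarrow> x \<in> U \<Longrightarrow> y \<in> U \<Longrightarrow> x - y \<in> U"
  using sgrp_add[of U x "- y"] sgrp_neg by auto

lemma sgrp_scl: "sgrp U \<Longrightarrow> x \<in> U \<Longrightarrow> scl c x \<in> U"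
  by (simp add: scl_def sgrp_0 sgrp_neg)

lemmas sgrp_intros = sgrp_0 sgrp_add sgrp_neg sgrp_diff sgrp_scl

text \<open>The form lives on the whole type and subspaces are subsets of it, so degeneracy is a
  property of a subset and not of \<open>B\<close>.\<close>

locale gf3_form =
  fixes B :: "'v::ab_group_add \<Rightarrow> 'v \<Rightarrow> gf3"
  assumes sym: "B x y = B y x"
    and add_left: "B (x + y) z = B x z + B y z"
    and triple: "x + x + x = (0::'v)"
begin

lemma add_self: "x + x = - (x::'v)"
  using triple[of x] by (simp add: eq_neg_iff_add_eq_0)

lemma scl_add: "scl (c + d) (x::'v) = scl c x + scl d x"
  by (cases c rule: gf3_exhaust; cases d rule: gf3_exhaust)
     (simp_all add: add_self minus_add_distrib[symmetric] del: minus_add_distrib)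

lemma zero_left [simp]: "B 0 z = 0"
  using add_left[of 0 0 z] by simp

lemma neg_left [simp]: "B (- x) z = - B x z"
  using add_left[of x "- x" z] by (simp add: eq_neg_iff_add_eq_0 add.commute)

lemma diff_left: "B (x - y) z = B x z - B y z"
  using add_left[of x "- y" z] by simp

lemma scl_left [simp]: "B (scl c x) z = c * B x z"
  by (cases c rule: gf3_exhaust) simp_all

lemma zero_right [simp]: "B z 0 = 0"
  and neg_right [simp]: "B z (- x) = - B z x"
  and add_right: "B z (x + y) = B z x + B z y"
  and diff_right: "B z (x - y) = B z x - B z y"
  and scl_right [simp]: "B z (scl c x) = c * B z x"
  by (simp_all add: sym[of z] add_left diff_left)

lemmas bilin = add_left diff_left add_right diff_right

definition perp :: "'v \<Rightarrow> 'v set \<Rightarrow> 'v set" where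
  "perp a U = {u \<in> U. B u a = 0}"

definition plus :: "'v set \<Rightarrow> 'v set" where
  "plus U = {u \<in> U. B u u = 1}"

definition rad :: "'v set \<Rightarrow> 'v set" where
  "rad U = {u \<in> U. \<forall>v\<in>U. B u v = 0}"

definition nondeg :: "'v set \<Rightarrow> bool" where
  "nondeg U \<longleftrightarrow> sgrp U \<and> finite U \<and> rad U \<subseteq> {0}"

lemma in_perp: "u \<in> perp a U \<longleftrightarrow> u \<in> U \<and> B u a = 0"
  by (simp add: perp_def)

lemma in_plus: "u \<in> plus U \<longleftrightarrow> u \<in> U \<and> B u u = 1"
  by (simp add: plus_def)

lemma perp_commute: "perp a (perp b U) = perp b (perp a U)"
  by (auto simp: perp_def)

lemma perp_0 [simp]: "perp 0 U = U"
  by (simp add: perp_def)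

lemma perp_minus [simp]: "perp (- a) U = perp a U"
  by (simp add: perp_def)

lemma sgrp_perp: "sgrp U \<Longrightarrow> sgrp (perp a U)"
  by (auto simp: sgrp_def perp_def add_left)

lemma finite_perp: "finite U \<Longrightarrow> finite (perp a U)"
  by (simp add: perp_def)

lemma nondegD: "nondeg U \<Longrightarrow> sgrp U" "nondeg U \<Longrightarrow> finite U"
  by (simp_all add: nondeg_def)

lemma nondeg_eq_0: "nondeg U \<Longrightarrow> u \<in> U \<Longrightarrow> (\<And>v. v \<in> U \<Longrightarrow> B u v = 0) \<Longrightarrow> u = 0"
  by (auto simp: nondeg_def rad_def)

lemma nondeg_card_rad: "nondeg U \<Longrightarrow> card (rad U) \<le> 1"
  unfolding nondeg_def using card_mono[of "{0}" "rad U"] by simp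

lemma plus_neg_iff [simp]: "sgrp U \<Longrightarrow> - u \<in> plus U \<longleftrightarrow> u \<in> plus U"
  by (simp add: in_plus sgrp_neg_iff)

lemma plus_not_0: "u \<in> plus U \<Longrightarrow> u \<noteq> 0"
  by (auto simp: in_plus)

text \<open>Each nonempty fibre of the functional given by \<open>a\<close> is a translate of its
  kernel, and there are three fibres. As \<open>a\<close> need not lie in \<open>U\<close>, the
  bound iterates along chains of perpendiculars.\<close>

lemma card_perp:
  assumes "sgrp U" "finite U"
  shows "card U \<le> 3 * card (perp a U)"
proof -
  let ?F = "\<lambda>c. {u \<in> U. B u a = c}"
  have fib: "card (?F c) \<le> card (perp a U)" for c
  proof (cases "?F c = {}")
    case False
    then obtain w where w: "w \<in> U" "B w a = c" by auto
    show ?thesis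
    proof (rule card_inj_on_le)
      show "inj_on (\<lambda>u. u - w) (?F c)" by (simp add: inj_on_def)
      show "(\<lambda>u. u - w) ` ?F c \<subseteq> perp a U"
        using w assms by (auto simp: in_perp diff_left sgrp_diff)
      show "finite (perp a U)" using assms by (simp add: finite_perp)
    qed
  next
    case True
    then show ?thesis unfolding True by simp
  qed
  have "U = ?F 0 \<union> ?F 1 \<union> ?F (- 1)"
    using gf3_exhaust by blast
  then have "card U \<le> card (?F 0) + card (?F 1) + card (?F (- 1))"
    by (metis (no_types, lifting) add_mono_thms_linordered_semiring(3) card_Un_le order_trans)
  then show ?thesis using fib[of 0] fib[of 1] fib[of "- 1"] by linarith
qed

text \<open>If some \<open>s\<close> is not perpendicular to \<open>u\<close>, the norms of
  \<open>s + scl l u\<close> run through all of GF(3) with \<open>l\<close>, so no norm can be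
  missing.\<close>

lemma isotropic_in_rad:
  assumes "sgrp U" and none: "\<And>u. u \<in> U \<Longrightarrow> B u u \<noteq> c" and u: "u \<in> U" "B u u = 0"
  shows "u \<in> rad U"
proof (rule ccontr)
  assume "u \<notin> rad U"
  then obtain s where s: "s \<in> U" "B u s \<noteq> 0" using u by (auto simp: rad_def)
  \<comment> \<open>Solves \<open>B s s - l * B u s = c\<close>; a nonzero scalar is its own
    inverse.\<close>
  define l where "l = (B s s - c) * B u s"
  have "B (s + scl l u) (s + scl l u) = B s s + (l * B u s + l * B u s)"
    using u by (simp add: bilin sym[of s u])
  also have "\<dots> = B s s - l * B u s" by (simp add: gf3_add_self)
  also have "\<dots> = c" unfolding l_def using gf3_square[OF s(2)] by (simp add: mult.assoc)
  finally show False using none assms(1) s u by (metis sgrp_add sgrp_scl)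
qed

text \<open>Suppose \<open>c\<close> is missing. Two perpendicular vectors of norm
  \<open>- c\<close> would add up to a vector of norm -2c = c, so the perpendicular of a vector of
  norm \<open>- c\<close> is totally isotropic, hence in the radical, and has index at most 3.
  Without vectors of norm \<open>- c\<close>, all of \<open>U\<close> is in the radical.\<close>

lemma exists_norm:
  assumes "sgrp U" "finite U" "c \<noteq> 0" "3 * card (rad U) < card U"
  shows "\<exists>u\<in>U. B u u = c"
proof (rule ccontr)
  assume "\<not> ?thesis"
  then have none: "\<And>u. u \<in> U \<Longrightarrow> B u u \<noteq> c" by blast
  have "finite (rad U)" using assms by (simp add: rad_def)
  have nrm: "B u u = 0 \<or> B u u = - c" if "u \<in> U" for u
    using none[OF that] assms(3) by (cases "B u u" rule: gf3_exhaust; cases c rule: gf3_exhaust) auto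
  show False
  proof (cases "\<exists>f\<in>U. B f f = - c")
    case True
    then obtain f where f: "f \<in> U" "B f f = - c" by blast
    have "perp f U \<subseteq> rad U"
    proof
      fix v assume v: "v \<in> perp f U"
      have "B v v \<noteq> - c"
      proof
        assume "B v v = - c"
        then have "B (v + f) (v + f) = c"
          using v f by (cases c rule: gf3_exhaust) (simp_all add: bilin sym[of f v] in_perp)
        then show False using none v f assms(1) by (metis in_perp sgrp_add)
      qed
      then show "v \<in> rad U"
        using nrm isotropic_in_rad[OF assms(1) none] v by (auto simp: in_perp)
    qed
    then have "card (perp f U) \<le> card (rad U)" using \<open>finite (rad U)\<close> by (rule card_mono[rotated])
    then show False using card_perp[OF assms(1,2), of f] assms(4) by linarith
  next
    case False
    then have "U \<subseteq> rad U" using nrm isotropic_in_rad[OF assms(1) none] by blast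
    then have "card U \<le> card (rad U)" using \<open>finite (rad U)\<close> by (rule card_mono[rotated])
    then show False using assms(4) by linarith
  qed
qed

lemma exists_plus:
  "sgrp U \<Longrightarrow> finite U \<Longrightarrow> 3 * card (rad U) < card U \<Longrightarrow> \<exists>u. u \<in> plus U"
  using exists_norm[of U 1] by (auto simp: in_plus)

lemma nondeg_exists_norm:
  "nondeg U \<Longrightarrow> c \<noteq> 0 \<Longrightarrow> 4 \<le> card U \<Longrightarrow> \<exists>u\<in>U. B u u = c"
  using exists_norm[of U c] nondeg_card_rad[of U] by (auto simp: nondegD)

lemma nondeg_perp:
  assumes "nondeg U" "a \<in> U" "B a a \<noteq> 0"
  shows "nondeg (perp a U)"
proof -
  have "u = 0" if u: "u \<in> perp a U" and z: "\<And>v. v \<in> perp a U \<Longrightarrow> B u v = 0" for u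
  proof (rule nondeg_eq_0[OF assms(1)])
    show "u \<in> U" using u by (simp add: in_perp)
    fix v assume v: "v \<in> U"
    \<comment> \<open>Projection of \<open>v\<close> off \<open>a\<close>; the norm of
      \<open>a\<close> is its own inverse.\<close>
    let ?w = "v - scl (B a a * B v a) a"
    have "?w \<in> perp a U"
      using v assms gf3_square[OF assms(3)] by (simp add: in_perp nondegD sgrp_intros diff_left mult.commute mult.left_commute)
    then have "B u ?w = 0" by (rule z)
    then show "B u v = 0" using u by (simp add: diff_right in_perp)
  qed
  then show ?thesis
    using assms(1) by (auto simp: nondeg_def sgrp_perp finite_perp rad_def)
qed

lemma nondeg_perp_plus: "nondeg U \<Longrightarrow> a \<in> plus U \<Longrightarrow> nondeg (perp a U)"
  by (simp add: nondeg_perp in_plus)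

text \<open>A functional vanishing on the kernel of another one is a multiple of it. Since
  \<open>y\<close> and \<open>a\<close> may lie outside \<open>U\<close>, equality is claimed only
  after pairing with \<open>U\<close>.\<close>

lemma perp_functional:
  assumes "sgrp U" and "\<And>u. u \<in> perp a U \<Longrightarrow> B y u = 0"
  shows "\<exists>c. \<forall>u\<in>U. B (y - scl c a) u = 0"
proof (cases "\<forall>u\<in>U. B a u = 0")
  case True
  then show ?thesis using assms(2) by (intro exI[of _ 0]) (auto simp: in_perp sym)
next
  case False
  then obtain w where w: "w \<in> U" "B a w \<noteq> 0" by blast
  \<comment> \<open>The factor is the quotient of \<open>B y w\<close> by \<open>B a w\<close>,
    which is its own inverse.\<close>
  have "B (y - scl (B a w * B y w) a) u = 0" if "u \<in> U" for u
  proof -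
    let ?v = "u - scl (B a u * B a w) w"
    have "B ?v a = B a u - B a u * (B a w * B a w)"
      by (simp add: diff_left sym[of u a] sym[of w a] mult.assoc)
    then have "?v \<in> perp a U"
      using w that assms(1) gf3_square[OF w(2)] by (simp add: in_perp sgrp_intros)
    then have "B y ?v = 0" by (rule assms(2))
    then show ?thesis by (simp add: diff_left diff_right algebra_simps)
  qed
  then show ?thesis by blast
qed

text \<open>The double perpendicular of four vectors is their span: one vector is peeled off at a
  time, and nondegeneracy kills the remainder. Zero vectors among the four give the cases of fewer
  vectors.\<close>

lemma perp_perp4:
  assumes "nondeg U" "{a, b, c, d} \<subseteq> U" "y \<in> U"
    and z: "\<And>u. u \<in> perp d (perp c (perp b (perp a U))) \<Longrightarrow> B y u = 0"
  shows "\<exists>i j k l. y = scl i a + scl j b + scl k c + scl l d"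
proof -
  note sg = nondegD(1)[OF assms(1)] sgrp_perp
  obtain l where "\<forall>u\<in>perp c (perp b (perp a U)). B (y - scl l d) u = 0"
    using perp_functional[of "perp c (perp b (perp a U))" d y] z sg by blast
  then obtain k where "\<forall>u\<in>perp b (perp a U). B (y - scl l d - scl k c) u = 0"
    using perp_functional[of "perp b (perp a U)" c] sg by blast
  then obtain j where "\<forall>u\<in>perp a U. B (y - scl l d - scl k c - scl j b) u = 0"
    using perp_functional[of "perp a U" b] sg by blast
  then obtain i where i: "\<forall>u\<in>U. B (y - scl l d - scl k c - scl j b - scl i a) u = 0"
    using perp_functional[of U a] sg by blast
  have "y - scl l d - scl k c - scl j b - scl i a \<in> U"
    using assms(2,3) sg by (simp add: sgrp_intros)
  with i have "y - scl l d - scl k c - scl j b - scl i a = 0"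
    using nondeg_eq_0[OF assms(1)] by blast
  then have "y = scl i a + scl j b + scl k c + scl l d"
    by (simp add: algebra_simps)
  then show ?thesis by blast
qed

lemma perp_perp2:
  assumes "nondeg U" "a \<in> U" "b \<in> U" "y \<in> U"
    and "\<And>u. u \<in> perp b (perp a U) \<Longrightarrow> B y u = 0"
  shows "\<exists>i j. y = scl i a + scl j b"
  using perp_perp4[of U 0 0 a b y] assms sgrp_0[OF nondegD(1)] by auto

lemma card_scl_combinations: "card {scl i a + scl j b |i j. True} \<le> 9"
proof -
  have "{scl i a + scl j b |i j. True} = (\<lambda>(i, j). scl i a + scl j b) ` UNIV" by auto
  then show ?thesis
    using card_image_le[of "UNIV :: (gf3 \<times> gf3) set" "\<lambda>(i, j). scl i a + scl j b"]
    by (simp add: card_UNIV_gf3 card_cartesian_product UNIV_Times_UNIV[symmetric] del: UNIV_Times_UNIV)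
qed

lemma card_scl_multiples: "card {scl i a |i. True} \<le> 3"
proof -
  have "{scl i a |i. True} = range (\<lambda>i. scl i a)" by auto
  then show ?thesis
    using card_image_le[of "UNIV :: gf3 set" "\<lambda>i. scl i a"] by (simp add: card_UNIV_gf3)
qed

lemma finite_scl_combinations: "finite {scl i a + scl j b |i j. True}"
  "finite {scl i a |i. True}"
proof -
  have "{scl i a + scl j b |i j. True} = (\<lambda>(i, j). scl i a + scl j b) ` UNIV" 
       "{scl i a |i. True} = range (\<lambda>i. scl i a)" by auto
  then show "finite {scl i a + scl j b |i j. True}" "finite {scl i a |i. True}" by simp_all
qed

text \<open>If only 0 were isotropic, every subgroup would be nondegenerate, so there would be
  perpendicular vectors of norms 1 and -1; their sum is isotropic.\<close>

lemma exists_isotropic: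
  assumes "sgrp U" "finite U" "27 \<le> card U"
  shows "\<exists>p\<in>U. p \<noteq> 0 \<and> B p p = 0"
proof (rule ccontr)
  assume "\<not> ?thesis"
  then have none: "\<And>p. p \<in> U \<Longrightarrow> B p p = 0 \<Longrightarrow> p = 0" by blast
  have rad: "nondeg W" if "W \<subseteq> U" "sgrp W" for W
    using none that finite_subset[OF that(1) assms(2)] by (auto simp: nondeg_def rad_def)
  obtain a where a: "a \<in> U" "B a a = 1"
    using nondeg_exists_norm[of U 1] rad[of U] assms by auto
  have "nondeg (perp a U)" by (rule rad) (auto simp: sgrp_perp[OF assms(1)] in_perp)
  moreover have "4 \<le> card (perp a U)" using card_perp[OF assms(1,2), of a] assms(3) by simp
  ultimately obtain t where t: "t \<in> perp a U" "B t t = - 1"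
    using nondeg_exists_norm[of "perp a U" "- 1"] by auto
  have "B (a + t) (a + t) = 0" using a t by (simp add: bilin in_perp sym[of a t])
  then have "a + t = 0" using none a t assms(1) by (simp add: in_perp sgrp_add)
  then have "t = - a" by (simp add: eq_neg_iff_add_eq_0 add.commute)
  then show False using a t by simp
qed

text \<open>An isotropic \<open>k\<close> is the difference of the plus vectors \<open>a + k\<close>
  and \<open>a\<close>, with \<open>a\<close> perpendicular to \<open>k\<close>. If \<open>k\<close>
  has norm -1 and \<open>t\<close> is perpendicular to it and of norm -1, the plus vectors
  \<open>t - k\<close> and \<open>- t - k\<close> add up to -2k = k.\<close>

lemma sgrp_spanned_by_plus:
  assumes "nondeg U" "81 \<le> card U" "sgrp D" "plus U \<subseteq> D"
  shows "U \<subseteq> D"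
proof
  note sg = nondegD(1)[OF assms(1)] and fin = nondegD(2)[OF assms(1)]
  fix k assume k: "k \<in> U"
  have cp: "27 \<le> card (perp k U)" using card_perp[OF sg fin, of k] assms(2) by simp
  show "k \<in> D"
  proof (cases "B k k" rule: gf3_exhaust)
    case 0
    \<comment> \<open>The radical is at most the line of \<open>k\<close>, and 3 * 3 < 27.\<close>
    have "rad (perp k U) \<subseteq> {scl i k |i. True}"
      using perp_perp2[of U 0 k] assms(1) k sgrp_0[OF sg] by (force simp: rad_def in_perp)
    then have "card (rad (perp k U)) \<le> 3"
      using card_mono[OF finite_scl_combinations(2)] card_scl_multiples order_trans by blast
    then obtain a where a: "a \<in> plus (perp k U)"
      using exists_plus[of "perp k U"] cp sg fin by (auto simp: sgrp_perp finite_perp)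
    then have "a \<in> plus U" "a + k \<in> plus U"
      using 0 k sg by (auto simp: in_plus in_perp bilin sgrp_add sym[of k a])
    then have "a + k - a \<in> D" using assms by (blast intro: sgrp_diff)
    then show ?thesis by simp
  next
    case 1
    then show ?thesis using assms k by (auto simp: in_plus)
  next
    case minus_1
    have "nondeg (perp k U)" using nondeg_perp[OF assms(1) k] minus_1 by simp
    then obtain t where t: "t \<in> perp k U" "B t t = - 1"
      using nondeg_exists_norm[of "perp k U" "- 1"] cp by auto
    then have "t - k \<in> plus U" "- t - k \<in> plus U"
      using minus_1 k sg by (auto simp: in_plus in_perp bilin sgrp_intros sym[of k t])
    then have "(t - k) + (- t - k) \<in> D" using assms by (blast intro: sgrp_add)
    moreover have "(t - k) + (- t - k) = - (k + k)" by simp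
    ultimately show ?thesis by (simp only: add_self minus_minus)
  qed
qed

section \<open>Rigidity of the graph on plus points\<close>


text \<open>The radical of the perpendicular of \<open>a\<close> and \<open>b\<close> is the
  isotropic line of \<open>a - b\<close>. Subtracting a multiple of \<open>a\<close> from
  \<open>x\<close> leaves a vector of this radical, so \<open>x\<close> lies on the line through
  \<open>a\<close> and \<open>b\<close>, which has just three plus points.\<close>

lemma third_point:
  assumes U: "nondeg U" "243 \<le> card U"
    and abx: "a \<in> plus U" "b \<in> plus U" "x \<in> plus U" and ab: "B a b = 1"
    and x: "\<And>d. d \<in> plus (perp b (perp a U)) \<Longrightarrow> B x d = 0"
  shows "x \<in> {a, - a, b, - b, a + b, - (a + b)}"
proof -
  note sg = nondegD(1)[OF U(1)] and fin = nondegD(2)[OF U(1)]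
  let ?W = "perp b (perp a U)"
  let ?r = "a - b"
  have sgW: "sgrp ?W" and finW: "finite ?W" using sg fin by (simp_all add: sgrp_perp finite_perp)
  have mem: "a \<in> U" "b \<in> U" "x \<in> U" and nrm: "B a a = 1" "B b b = 1" "B x x = 1"
    using abx by (simp_all add: in_plus)
  have ba: "B b a = 1" using ab by (simp add: sym)
  have rW: "?r \<in> ?W" "B ?r ?r = 0"
    using mem nrm ab ba sg by (simp_all add: in_perp sgrp_diff bilin)
  have mult_r: "\<exists>i. y = scl i ?r" if yW: "y \<in> ?W" and y: "\<And>u. u \<in> ?W \<Longrightarrow> B y u = 0" for y
  proof -
    have "y \<in> U" using yW by (simp add: in_perp)
    from perp_perp2[OF U(1) mem(1,2) this y] obtain i j where ij: "y = scl i a + scl j b"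
      by blast
    have "i + j = 0" using yW nrm ba unfolding ij in_perp by (simp add: bilin)
    then have "j = - i" by (simp add: eq_neg_iff_add_eq_0 add.commute)
    then have "y = scl i ?r" unfolding ij by (cases i rule: gf3_exhaust) simp_all
    then show ?thesis by blast
  qed
  have "rad ?W \<subseteq> {scl i ?r |i. True}"
    using mult_r unfolding rad_def by blast
  then have "card (rad ?W) \<le> 3"
    using card_mono[OF finite_scl_combinations(2)] card_scl_multiples order_trans by blast
  moreover have "27 \<le> card ?W"
    using card_perp[OF sg fin, of a] card_perp[of "perp a U" b] sg fin U(2)
    by (simp add: sgrp_perp finite_perp)
  ultimately obtain d where d: "d \<in> plus ?W" using exists_plus[of ?W] sgW finW by auto
  \<comment> \<open>Two plus vectors of \<open>?W\<close> that differ by \<open>?r\<close> force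
    \<open>x\<close> to be perpendicular to \<open>?r\<close>.\<close>
  have "d + ?r \<in> plus ?W"
    using d rW sg by (auto simp: in_plus in_perp bilin sgrp_add sym[of a d] sym[of b d])
  then have "B x ?r = 0" using x[OF d] x[of "d + ?r"] by (simp add: add_right)
  define al where "al = B x a"
  have al: "B x a = al" "B x b = al" "B a x = al" "B b x = al"
    using \<open>B x ?r = 0\<close> by (simp_all add: al_def diff_right sym[of a x] sym[of b x])
  define y where "y = x - scl al a"
  have yW: "y \<in> ?W" using al mem nrm ab sg by (simp add: y_def in_perp bilin sgrp_intros)
  have yd: "B y d = 0" if "d \<in> plus ?W" for d
    using x[OF that] that by (simp add: y_def diff_left in_plus in_perp sym[of a d])
  have yy: "B y y = 1 - al * al"
    using al nrm by (simp add: y_def bilin)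
  \<comment> \<open>Otherwise \<open>y\<close> equals \<open>x\<close> and would be a plus vector
    perpendicular to itself.\<close>
  have al0: "al \<noteq> 0"
  proof
    assume "al = 0"
    then have "y \<in> plus ?W" using yW yy by (simp add: in_plus)
    then show False using yd yy \<open>al = 0\<close> by fastforce
  qed
  have "B y s = 0" if s: "s \<in> ?W" for s
  proof (rule ccontr)
    assume ns: "B y s \<noteq> 0"
    \<comment> \<open>This multiple of the isotropic \<open>y\<close> turns \<open>s\<close> into a
      plus vector still not perpendicular to \<open>y\<close>.\<close>
    define l where "l = (B s s - 1) * B y s"
    let ?v = "s + scl l y"
    have y0: "B y y = 0" using yy al0 by (simp add: gf3_square)
    have "B ?v ?v = B s s + (l * B y s + l * B y s)"
      using y0 by (simp add: bilin sym[of s y])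
    also have "\<dots> = B s s - l * B y s" by (simp add: gf3_add_self)
    also have "\<dots> = 1" unfolding l_def using gf3_square[OF ns] by (simp add: mult.assoc)
    finally have "?v \<in> plus ?W" using s yW sgW by (simp add: in_plus sgrp_intros)
    then show False using yd[of ?v] ns y0 by (simp add: add_right)
  qed
  then obtain i where "y = scl i ?r" using mult_r[OF yW] by blast
  then have xe: "x = scl al a + scl i (a - b)" unfolding y_def by (simp add: algebra_simps)
  have aab: "a + (a - b) = - (a + b)" using add_self[of a] by (simp add: algebra_simps)
  have aab': "- a + - (a - b) = a + b" using aab by (metis minus_add_distrib minus_minus)
  show ?thesis using al0 unfolding xe
    by (cases al rule: gf3_exhaust; cases i rule: gf3_exhaust) (simp_all only: scl_simps aab aab', auto)
qed

text \<open>A model names each vertex by the two vectors of a point. Working with functions on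
  vectors that identify exactly \<open>v\<close> and \<open>- v\<close> avoids a quotient.\<close>

definition models :: "'v set \<Rightarrow> ('v \<Rightarrow> 'a) \<Rightarrow> 'a set \<Rightarrow> ('a \<Rightarrow> 'a \<Rightarrow> bool) \<Rightarrow> bool" where
  "models U f W R \<longleftrightarrow> f ` plus U = W \<and>
     (\<forall>u\<in>plus U. \<forall>v\<in>plus U. (f u = f v \<longleftrightarrow> u = v \<or> u = - v) \<and> (R (f u) (f v) \<longleftrightarrow> B u v = 0))"

lemma models_eq_iff:
  "models U f W R \<Longrightarrow> u \<in> plus U \<Longrightarrow> v \<in> plus U \<Longrightarrow> f u = f v \<longleftrightarrow> u = v \<or> u = - v"
  and models_adj_iff:
  "models U f W R \<Longrightarrow> u \<in> plus U \<Longrightarrow> v \<in> plus U \<Longrightarrow> R (f u) (f v) \<longleftrightarrow> B u v = 0"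
  and models_in: "models U f W R \<Longrightarrow> u \<in> plus U \<Longrightarrow> f u \<in> W"
  and models_image: "models U f W R \<Longrightarrow> f ` plus U = W"
  unfolding models_def by blast+

lemma models_neg: "models U f W R \<Longrightarrow> sgrp U \<Longrightarrow> u \<in> plus U \<Longrightarrow> f (- u) = f u"
  by (subst models_eq_iff[of U f W R]) auto

text \<open>Neighbourhoods in the graph are perpendiculars in the space; iteration gives common
  neighbourhoods.\<close>

lemma models_perp:
  assumes "models U f W R" "a \<in> plus U"
  shows "models (perp a U) f {w \<in> W. R (f a) w} R"
proof -
  have "f ` plus (perp a U) = {w \<in> W. R (f a) w}"
  proof
    show "f ` plus (perp a U) \<subseteq> {w \<in> W. R (f a) w}"
    proof
      fix w assume "w \<in> f ` plus (perp a U)"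
      then obtain u where "u \<in> plus U" "B a u = 0" "w = f u" by (auto simp: in_plus in_perp sym)
      then show "w \<in> {w \<in> W. R (f a) w}" using assms by (simp add: models_in models_adj_iff)
    qed
    show "{w \<in> W. R (f a) w} \<subseteq> f ` plus (perp a U)"
    proof
      fix w assume w: "w \<in> {w \<in> W. R (f a) w}"
      then obtain u where u: "u \<in> plus U" "w = f u" using assms by (auto simp: models_def)
      then have "B a u = 0" using w assms by (simp add: models_adj_iff)
      then show "w \<in> f ` plus (perp a U)" using u by (auto simp: in_plus in_perp sym[of a u])
    qed
  qed
  moreover have "plus (perp a U) \<subseteq> plus U" by (auto simp: in_plus in_perp)
  ultimately show ?thesis using assms(1) unfolding models_def by blast
qed

section \<open>Isometries and transport of models\<close>

definition isom :: "'v set \<Rightarrow> ('v \<Rightarrow> 'v) \<Rightarrow> bool" where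
  "isom U L \<longleftrightarrow> L ` U \<subseteq> U \<and> (\<forall>u\<in>U. \<forall>v\<in>U. L (u + v) = L u + L v \<and> B (L u) (L v) = B u v)"

lemma isom_in: "isom U L \<Longrightarrow> u \<in> U \<Longrightarrow> L u \<in> U"
  and isom_add: "isom U L \<Longrightarrow> u \<in> U \<Longrightarrow> v \<in> U \<Longrightarrow> L (u + v) = L u + L v"
  and isom_B: "isom U L \<Longrightarrow> u \<in> U \<Longrightarrow> v \<in> U \<Longrightarrow> B (L u) (L v) = B u v"
  unfolding isom_def by blast+

lemma isom_neg:
  assumes "isom U L" "sgrp U" "u \<in> U" shows "L (- u) = - L u"
proof -
  have "L 0 + L 0 = L 0" using assms isom_add[of U L 0 0] by (simp add: sgrp_0)
  then have "L 0 = 0" by simp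
  moreover have "L (u + - u) = L u + L (- u)" using assms by (intro isom_add) (auto intro: sgrp_neg)
  ultimately show ?thesis by (simp add: eq_neg_iff_add_eq_0 add.commute)
qed

lemma isom_scl: "isom U L \<Longrightarrow> sgrp U \<Longrightarrow> u \<in> U \<Longrightarrow> L (scl c u) = scl c (L u)"
  using isom_neg[of U L u] isom_neg[of U L 0]
  by (cases c rule: gf3_exhaust) (auto simp: sgrp_0, metis add.right_neutral add_left_cancel isom_add sgrp_0)

lemma isom_plus: "isom U L \<Longrightarrow> u \<in> plus U \<Longrightarrow> L u \<in> plus U"
  by (auto simp: in_plus isom_in isom_B)

lemma isom_inj:
  assumes "isom U L" "nondeg U" shows "inj_on L U"
proof
  fix u v assume uv: "u \<in> U" "v \<in> U" "L u = L v"
  have sg: "sgrp U" using assms by (simp add: nondegD)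
  have "u - v = 0"
  proof (rule nondeg_eq_0[OF assms(2)])
    show "u - v \<in> U" using sg uv by (simp add: sgrp_diff)
    fix w assume "w \<in> U"
    then show "B (u - v) w = 0"
      using uv isom_B[OF assms(1), of u w] isom_B[OF assms(1), of v w] by (simp add: diff_left)
  qed
  then show "u = v" by simp
qed

lemma isom_onto: "isom U L \<Longrightarrow> nondeg U \<Longrightarrow> L ` U = U"
  using isom_inj[of U L] endo_inj_surj[of U L] nondegD(2)[of U] by (simp add: isom_def)

text \<open>The second form may live on another group, so this serves both for isometries within one
  space and for changes of Gram matrix.\<close>

lemma models_comp:
  fixes B' :: "'w::ab_group_add \<Rightarrow> 'w \<Rightarrow> gf3" and L :: "'v \<Rightarrow> 'w"
  assumes "gf3_form B'" and f: "gf3_form.models B' U2 f W R"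
    and "sgrp U1" "inj_on L U1" "L ` U1 = U2"
    and add: "\<And>u v. u \<in> U1 \<Longrightarrow> v \<in> U1 \<Longrightarrow> L (u + v) = L u + L v"
    and iso: "\<And>u v. u \<in> U1 \<Longrightarrow> v \<in> U1 \<Longrightarrow> B' (L u) (L v) = B u v"
  shows "models U1 (f \<circ> L) W R"
proof -
  interpret B': gf3_form B' by fact
  have "L 0 + L 0 = L 0" using add[of 0 0] assms(3) by (simp add: sgrp_0)
  then have neg: "L (- u) = - L u" if "u \<in> U1" for u
    using that add[of u "- u"] assms(3) by (simp add: sgrp_neg eq_neg_iff_add_eq_0 add.commute)
  have eq: "L u = L v \<or> L u = - L v \<longleftrightarrow> u = v \<or> u = - v" if "u \<in> U1" "v \<in> U1" for u v
    using that assms(3,4) by (simp add: neg[symmetric] inj_on_eq_iff sgrp_neg)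
  have pl: "L ` plus U1 = B'.plus U2"
    using assms(5) iso by (fastforce simp: in_plus B'.in_plus image_iff)
  have "(f \<circ> L) ` plus U1 = W"
    using B'.models_image[OF f] by (simp only: image_comp[symmetric] pl)
  moreover have "L u \<in> B'.plus U2" if "u \<in> plus U1" for u using pl that by blast
  ultimately show ?thesis using f eq iso unfolding models_def B'.models_def
    by (auto simp: in_plus)
qed

lemma models_isom: "models U f W R \<Longrightarrow> nondeg U \<Longrightarrow> isom U L \<Longrightarrow> models U (f \<circ> L) W R"
  by (rule models_comp[OF gf3_form_axioms, of U])
    (auto simp: isom_inj isom_onto nondegD isom_add isom_B)

text \<open>The additive extension of a partial map, kept as a relation because it is seen to be
  single-valued only after inner products are controlled.\<close>

inductive additive_span :: "('v \<times> 'v) set \<Rightarrow> 'v \<Rightarrow> 'v \<Rightarrow> bool" for S where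
  span_0: "additive_span S 0 0"
| span_base: "(u, u') \<in> S \<Longrightarrow> additive_span S u u'"
| span_add: "additive_span S u u' \<Longrightarrow> additive_span S v v' \<Longrightarrow> additive_span S (u + v) (u' + v')"
| span_neg: "additive_span S u u' \<Longrightarrow> additive_span S (- u) (- u')"

lemma additive_span_B:
  assumes "additive_span S u u'" "additive_span S v v'"
    and S: "\<And>u u' v v'. (u, u') \<in> S \<Longrightarrow> (v, v') \<in> S \<Longrightarrow> B u' v' = B u v"
  shows "B u' v' = B u v"
proof -
  have 1: "B u' w' = B u w" if "(w, w') \<in> S" for w w'
    using assms(1) by induction (auto simp: bilin S that)
  show ?thesis using assms(2) by induction (auto simp: bilin 1)
qed

text \<open>The sign of each image is fixed by comparison with one vector; that the normalised
  images keep all inner products is because the sign of \<open>(a,b)(b,c)(c,a)\<close> records whether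
  the third point of the line through \<open>a\<close> and \<open>b\<close> is perpendicular to \<open>c\<close>.\<close>

theorem models_rigid:
  assumes U: "nondeg U" "243 \<le> card U" and f: "models U f W R" and g: "models U g W R"
  shows "\<exists>L. isom U L \<and> (\<forall>u\<in>plus U. f u = g (L u))"
proof -
  note sg = nondegD(1)[OF U(1)] and fin = nondegD(2)[OF U(1)]
  have "\<forall>u\<in>plus U. \<exists>w\<in>plus U. g w = f u"
    using models_in[OF f] models_image[OF g] by (metis (no_types, lifting) imageE)
  then obtain h where h: "\<And>u. u \<in> plus U \<Longrightarrow> h u \<in> plus U" "\<And>u. u \<in> plus U \<Longrightarrow> g (h u) = f u"
    by metis
  have h_perp: "B (h u) (h v) = 0 \<longleftrightarrow> B u v = 0" if "u \<in> plus U" "v \<in> plus U" for u v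
    using that models_adj_iff[OF g, of "h u" "h v"] models_adj_iff[OF f, of u v] h by simp
  have h_eq: "h u = h v \<or> h u = - h v \<longleftrightarrow> u = v \<or> u = - v" if "u \<in> plus U" "v \<in> plus U" for u v
    using that models_eq_iff[OF g, of "h u" "h v"] models_eq_iff[OF f, of u v] h by simp
  have h_surj: "\<exists>u\<in>plus U. w = h u \<or> w = - h u" if "w \<in> plus U" for w
  proof -
    obtain u where u: "u \<in> plus U" "f u = g w"
      using models_in[OF g \<open>w \<in> plus U\<close>] models_image[OF f] by (metis (no_types, lifting) imageE)
    then show ?thesis using models_eq_iff[OF g that h(1)[OF u(1)]] h(2) by metis
  qed
  \<comment> \<open>The third point of a line goes to the third point of the image line:
    perpendicularity puts it on that line, and injectivity excludes the two known points.\<close>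
  have third: "h (a + b) = a' + b' \<or> h (a + b) = - (a' + b')"
    if a: "a \<in> plus U" "a' = h a \<or> a' = - h a" and b: "b \<in> plus U" "b' = h b \<or> b' = - h b"
      and ab: "B a b = 1" "B a' b' = 1" and ne: "a \<noteq> b" for a b a' b'
  proof -
    have ba: "B b a = 1" using ab by (simp add: sym)
    have nm: "a \<noteq> - b" using ab b by (auto simp: in_plus)
    have x: "a + b \<in> plus U" using a b ab ba sg by (simp add: in_plus bilin sgrp_add)
    have a'b': "a' \<in> plus U" "b' \<in> plus U" using a b h sg by auto
    have "B (h (a + b)) d = 0" if d: "d \<in> plus (perp b' (perp a' U))" for d
    proof -
      have "d \<in> plus U" using d by (simp add: in_plus in_perp)
      then obtain c where c: "c \<in> plus U" "d = h c \<or> d = - h c" using h_surj by blast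
      have "B (h c) (h a) = 0" "B (h c) (h b) = 0"
        using c(2) d a b by (auto simp: in_plus in_perp)
      then have "B c a = 0" "B c b = 0" using h_perp a b c by auto
      then have "B (h (a + b)) (h c) = 0"
        using h_perp[OF x c(1)] by (simp add: add_left sym[of a c] sym[of b c])
      then show ?thesis using c(2) by auto
    qed
    from third_point[OF U a'b' h(1)[OF x] ab(2) this]
    have "h (a + b) = a' + b' \<or> h (a + b) = - (a' + b') \<or> h (a + b) = h a \<or> h (a + b) = - h a
        \<or> h (a + b) = h b \<or> h (a + b) = - h b"
      using a(2) b(2) by auto
    moreover have "a + b \<noteq> a" "a + b \<noteq> b" using plus_not_0[OF a(1)] plus_not_0[OF b(1)] by auto
    moreover have "a + b \<noteq> - a"
    proof
      assume "a + b = - a"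
      then have "a + b = a + a" by (simp only: add_self)
      then show False using ne by simp
    qed
    moreover have "a + b \<noteq> - b"
    proof
      assume "a + b = - b"
      then have "a + b = b + b" by (simp only: add_self)
      then show False using ne by simp
    qed
    ultimately show ?thesis using h_eq[OF x a(1)] h_eq[OF x b(1)] by blast
  qed
  obtain a where a: "a \<in> plus U"
    using nondeg_exists_norm[OF U(1), of 1] U(2) by (auto simp: in_plus)
  \<comment> \<open>Signs are normalised against \<open>a\<close>, which is possible only for
    vectors not perpendicular to \<open>a\<close>.\<close>
  define N where "N = {u \<in> plus U. B a u \<noteq> 0}"
  define G where "G u = (if B (h a) (h u) = B a u then h u else - h u)" for u
  have NU: "u \<in> N \<Longrightarrow> u \<in> plus U" "u \<in> N \<Longrightarrow> B a u \<noteq> 0" for u by (auto simp: N_def)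
  have G_pm: "G u = h u \<or> G u = - h u" for u by (simp add: G_def)
  have G_plus: "G u \<in> plus U" if "u \<in> N" for u using G_pm[of u] h(1) NU that sg by auto
  have aN: "a \<in> N" using a by (simp add: N_def in_plus)
  have Ga: "G a = h a" using h(1)[OF a] a by (simp add: G_def in_plus)
  have G_a: "B (G a) (G u) = B a u" if "u \<in> N" for u
  proof -
    have "B (h a) (h u) \<noteq> 0" "B a u \<noteq> 0" using h_perp[OF a, of u] NU that by auto
    then have "B (h a) (h u) = B a u \<or> B (h a) (h u) = - B a u"
      by (cases "B a u" rule: gf3_exhaust; cases "B (h a) (h u)" rule: gf3_exhaust) auto
    then show ?thesis unfolding Ga by (auto simp: G_def)
  qed
  have G_B: "B (G u) (G v) = B u v" if u: "u \<in> N" and v: "v \<in> N" for u v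
  proof -
    define al be de de' where "al = B a u" "be = B a v" "de = B u v" "de' = B (G u) (G v)"
    have nz: "al \<noteq> 0" "be \<noteq> 0" using u v NU by (auto simp: al_be_de_de'_def)
    have iff0: "de' = 0 \<longleftrightarrow> de = 0"
      using h_perp[of u v] NU u v G_pm[of u] G_pm[of v] by (auto simp: al_be_de_de'_def)
    consider "u = a" | "u = - a" | "u \<noteq> a" "u \<noteq> - a" by blast
    then show ?thesis
    proof cases
      case 1
      then show ?thesis using G_a v by simp
    next
      case 2
      have "h u = h a \<or> h u = - h a" using h_eq[of u a] NU(1)[OF u] a 2 by auto
      then have "G u = G a \<or> G u = - G a" using G_pm[of u] unfolding Ga by auto
      moreover have "B (G a) (G u) = - 1" "B (G a) (G a) = 1"
        using G_a[OF u] 2 a G_plus[OF aN] by (auto simp: in_plus)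
      ultimately have "G u = - G a" by auto
      then show ?thesis using G_a[OF v] 2 by simp
    next
      case 3
      \<comment> \<open>The sign is chosen so that \<open>B a ?w = 1\<close>; then
        \<open>a + ?w\<close> is the third plus point of the line.\<close>
      let ?w = "scl al u" and ?w' = "scl al (G u)"
      have w: "?w \<in> plus U" using u NU(1)[OF u] sg nz gf3_square[OF nz(1)]
        by (simp add: in_plus sgrp_scl mult.assoc[symmetric])
      have wpm: "?w = u \<or> ?w = - u" "?w' = G u \<or> ?w' = - G u"
        using nz by (auto simp: scl_def)
      have hw: "h ?w = h u \<or> h ?w = - h u" using h_eq[OF w NU(1)[OF u]] wpm by auto
      have "h (a + ?w) = G a + ?w' \<or> h (a + ?w) = - (G a + ?w')"
      proof (rule third[OF a _ w])
        show "G a = h a \<or> G a = - h a" using Ga by simp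
        show "?w' = h ?w \<or> ?w' = - h ?w" using wpm hw G_pm[of u] by auto
        show "B a ?w = 1" using gf3_square[OF nz(1)] by (simp add: al_be_de_de'_def)
        show "B (G a) ?w' = 1" using gf3_square[OF nz(1)] G_a[OF u] by (simp add: al_be_de_de'_def)
        show "a \<noteq> ?w" using 3 wpm by auto
      qed
      moreover have "a + ?w \<in> plus U"
        using a w sg gf3_square[OF nz(1)]
        by (simp add: in_plus sgrp_add bilin sym[of u a] al_be_de_de'_def distrib_left)
      ultimately have "B (G a + ?w') (h v) = 0 \<longleftrightarrow> B (a + ?w) v = 0"
        using h_perp[of "a + ?w" v] NU(1)[OF v] neg_left[of "G a + ?w'" "h v"]
        by (auto simp del: minus_add_distrib neg_left)
      then have "B (G a + ?w') (G v) = 0 \<longleftrightarrow> B (a + ?w) v = 0"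
        using G_pm[of v] by auto
      \<comment> \<open>Just one nonzero value in place of \<open>de\<close> makes the sum vanish,
        so the equivalence together with \<open>iff0\<close> determines \<open>de'\<close>.\<close>
      then have "be + al * de' = 0 \<longleftrightarrow> be + al * de = 0"
        using G_a[OF v] by (simp add: bilin al_be_de_de'_def)
      then have "de' = de" using nz iff0
        by (cases al rule: gf3_exhaust; cases be rule: gf3_exhaust;
            cases de rule: gf3_exhaust; cases de' rule: gf3_exhaust) simp_all
      then show ?thesis by (simp add: al_be_de_de'_def)
    qed
  qed
  \<comment> \<open>Vectors perpendicular to \<open>a\<close> are reached as third points:
    \<open>b\<close> and \<open>- c\<close> are not perpendicular to \<open>a\<close>, have inner
    product 1 and add up to \<open>d\<close>.\<close>
  have split: "\<exists>b c. b \<in> N \<and> c \<in> N \<and> d = b - c \<and> B b c = - 1" if d: "d \<in> plus U" "B a d = 0" for d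
  proof -
    let ?W = "perp d (perp a U)"
    have da: "d \<in> plus (perp a U)" using d by (simp add: in_plus in_perp sym[of a d])
    have "nondeg ?W" using nondeg_perp_plus[OF nondeg_perp_plus[OF U(1) a] da] .
    moreover have "27 \<le> card ?W"
      using card_perp[OF sg fin, of a] card_perp[of "perp a U" d] sg fin U(2)
      by (simp add: sgrp_perp finite_perp)
    ultimately obtain t where t: "t \<in> ?W" "B t t = - 1"
      using nondeg_exists_norm[of ?W "- 1"] by auto
    have tt: "B t a = 0" "B t d = 0" "B a t = 0" "B d t = 0" "B d a = 0" "t \<in> U"
      using t d by (auto simp: in_perp sym[of a t] sym[of d t] sym[of d a])
    \<comment> \<open>Both vectors have norm 1 + 1 - 1, because a + 2d + t = a - d + t.\<close>
    let ?c = "a + d + t" and ?b = "a + d + t + d"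
    have "?c \<in> plus U" "?b \<in> plus U"
      using a d tt t(2) sg by (simp_all add: in_plus sgrp_add bilin)
    then have "?c \<in> N" "?b \<in> N" "B ?b ?c = - 1"
      using a d tt t(2) by (simp_all add: N_def in_plus bilin)
    moreover have "d = ?b - ?c" by simp
    ultimately show ?thesis by blast
  qed
  \<comment> \<open>The generated relation will be total because plus vectors span, and
    single-valued because it keeps inner products and the form is nondegenerate.\<close>
  define S where "S = {(u, G u) |u. u \<in> N}"
  let ?R = "additive_span S"
  have R_B: "B u' v' = B u v" if "?R u u'" "?R v v'" for u u' v v'
    using additive_span_B[OF that] G_B by (auto simp: S_def)
  have R_U: "u' \<in> U" if "?R u u'" for u u'
    using that sg G_plus by induction (auto simp: S_def sgrp_intros in_plus)
  have R_N: "?R u (G u)" if "u \<in> N" for u using that by (auto simp: S_def intro: span_base)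
  have "sgrp {u. \<exists>u'. ?R u u'}"
    unfolding sgrp_def by (auto intro: span_0 span_add span_neg)
  moreover have "plus U \<subseteq> {u. \<exists>u'. ?R u u'}"
  proof
    fix d assume d: "d \<in> plus U"
    show "d \<in> {u. \<exists>u'. ?R u u'}"
    proof (cases "B a d = 0")
      case True
      then obtain b c where "b \<in> N" "c \<in> N" "d = b - c" using split d by blast
      then have "?R (b + - c) (G b + - G c)" by (intro span_add span_neg R_N)
      then show ?thesis using \<open>d = b - c\<close> by auto
    next
      case False
      then have "d \<in> N" using d by (simp add: N_def)
      then show ?thesis using R_N by blast
    qed
  qed
  ultimately have "U \<subseteq> {u. \<exists>u'. ?R u u'}" using sgrp_spanned_by_plus[OF U(1)] U(2) by auto
  then have "\<forall>u\<in>U. \<exists>u'. ?R u u'" by blast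
  then obtain L where L: "\<And>u. u \<in> U \<Longrightarrow> ?R u (L u)" by metis
  have LU: "L u \<in> U" if "u \<in> U" for u using R_U L that by blast
  have LB: "B (L u) (L v) = B u v" if "u \<in> U" "v \<in> U" for u v using R_B L that by blast
  have "inj_on L U"
  proof
    fix u v assume uv: "u \<in> U" "v \<in> U" "L u = L v"
    have "u - v = 0"
    proof (rule nondeg_eq_0[OF U(1)])
      show "u - v \<in> U" using sg uv by (simp add: sgrp_diff)
      fix w assume "w \<in> U"
      then show "B (u - v) w = 0" using uv LB[of u w] LB[of v w] by (simp add: diff_left)
    qed
    then show "u = v" by simp
  qed
  then have onto: "L ` U = U" using LU fin by (simp add: endo_inj_surj image_subsetI)
  have R_fun: "u' = L u" if "u \<in> U" "?R u u'" for u u'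
  proof -
    have "u' - L u = 0"
    proof (rule nondeg_eq_0[OF U(1)])
      show "u' - L u \<in> U" using sg that LU R_U by (simp add: sgrp_diff)
      fix w assume "w \<in> U"
      then obtain v where "v \<in> U" "w = L v" using onto by blast
      then show "B (u' - L u) w = 0"
        using R_B[OF that(2) L] R_B[OF L L] that(1) by (simp add: diff_left)
    qed
    then show ?thesis by simp
  qed
  have L_add: "L (u + v) = L u + L v" if "u \<in> U" "v \<in> U" for u v
    using R_fun[of "u + v" "L u + L v"] span_add[OF L L] that sg by (simp add: sgrp_add)
  have iso: "isom U L" using LU LB L_add by (auto simp: isom_def)
  have LG: "L u = G u" if "u \<in> N" for u
    using R_fun[OF _ R_N[OF that]] NU(1)[OF that] by (simp add: in_plus)
  have "L u = h u \<or> L u = - h u" if u: "u \<in> plus U" for u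
  proof (cases "B a u = 0")
    case True
    then obtain b c where bc: "b \<in> N" "c \<in> N" "u = b - c" "B b c = - 1" using split u by blast
    have c': "- c \<in> plus U" using NU(1)[OF bc(2)] sg by simp
    have hc: "h (- c) = h c \<or> h (- c) = - h c" using h_eq[OF c' NU(1)[OF bc(2)]] by simp
    have "h (b + - c) = G b + - G c \<or> h (b + - c) = - (G b + - G c)"
    proof (rule third[OF NU(1)[OF bc(1)] G_pm c'])
      show "- G c = h (- c) \<or> - G c = - h (- c)" using hc G_pm[of c] by auto
      show "B b (- c) = 1" "B (G b) (- G c) = 1" using bc G_B[of b c] by auto
      show "b \<noteq> - c"
      proof
        assume "b = - c"
        then have "u = - c + - c" using bc(3) by simp
        then have "u = c" using add_self[of "- c"] by simp
        then show False using True NU(2)[OF bc(2)] by simp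
      qed
    qed
    moreover have "L u = G b + - G c"
    proof -
      have "L (b + - c) = L b + L (- c)"
        using NU(1)[OF bc(1)] c' by (intro L_add) (auto simp: in_plus)
      also have "L (- c) = - L c" using isom_neg[OF iso sg] NU(1)[OF bc(2)] by (simp add: in_plus)
      finally show ?thesis using LG bc by simp
    qed
    ultimately show ?thesis using bc(3) by auto
  next
    case False
    then show ?thesis using LG[of u] G_pm[of u] u by (auto simp: N_def)
  qed
  then have "f u = g (L u)" if "u \<in> plus U" for u
    using that h models_neg[OF g sg h(1)[OF that]] by metis
  then show ?thesis using iso by blast
qed


text \<open>For \<open>c\<close> of nonzero norm this is the usual reflection u - 2(u,c)/(c,c) c,
  since -2 = 1 and the norm is its own inverse.\<close>

definition refl :: "'v \<Rightarrow> 'v \<Rightarrow> 'v" where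
  "refl c u = u + scl (B c c * B u c) c"

lemma refl_isom:
  assumes "sgrp U" "c \<in> U" "B c c \<noteq> 0"
  shows "isom U (refl c)"
proof -
  have "B (refl c u) (refl c v) = B u v" for u v
    using assms(3) unfolding refl_def
    by (simp add: bilin sym[of c v])
      (cases "B c c" rule: gf3_exhaust; cases "B u c" rule: gf3_exhaust;
       cases "B v c" rule: gf3_exhaust; simp)
  moreover have "refl c (u + v) = refl c u + refl c v" for u v
    by (simp add: refl_def add_left distrib_left scl_add)
  ultimately show ?thesis using assms by (auto simp: isom_def refl_def sgrp_intros)
qed

text \<open>One of \<open>x - y\<close> and \<open>x + y\<close> has nonzero norm, and its
  reflection takes \<open>x\<close> to \<open>y\<close> or \<open>- y\<close>; composition with -1
  repairs the sign.\<close>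

lemma isom_transitive:
  assumes "sgrp U" "x \<in> plus U" "y \<in> plus U"
  shows "\<exists>L. isom U L \<and> L x = y"
proof -
  have mem: "x \<in> U" "y \<in> U" "B x x = 1" "B y y = 1" using assms by (auto simp: in_plus)
  have neg: "\<exists>L. isom U L \<and> L x = - z" if "isom U L" "L x = z" for L z
    using that assms(1) by (intro exI[of _ "\<lambda>u. - L u"]) (auto simp: isom_def sgrp_neg)
  have id: "isom U (\<lambda>u. u)" by (simp add: isom_def)
  show ?thesis
  proof (cases "B x y" rule: gf3_exhaust)
    case 0
    then have yx: "B y x = 0" by (simp add: sym)
    have n: "B (x - y) (x - y) = - 1" using 0 yx mem by (simp add: bilin)
    then have "isom U (refl (x - y))" using assms(1) mem by (intro refl_isom) (auto simp: sgrp_diff)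
    moreover have "refl (x - y) x = y" unfolding refl_def n using 0 mem by (simp add: bilin)
    ultimately show ?thesis by blast
  next
    case 1
    then have yx: "B y x = 1" by (simp add: sym)
    have n: "B (x + y) (x + y) = 1" using 1 yx mem by (simp add: bilin)
    then have "isom U (refl (x + y))" using assms(1) mem by (intro refl_isom) (auto simp: sgrp_add)
    moreover have "refl (x + y) x = - y" unfolding refl_def n using 1 mem by (simp add: bilin)
    ultimately show ?thesis using neg[of "refl (x + y)" "- y"] by simp
  next
    case minus_1
    then have yx: "B y x = - 1" by (simp add: sym)
    have n: "B (x - y) (x - y) = 1" using minus_1 yx mem by (simp add: bilin)
    then have "isom U (refl (x - y))" using assms(1) mem by (intro refl_isom) (auto simp: sgrp_diff)
    moreover have "refl (x - y) x = y" unfolding refl_def n using minus_1 mem by (simp add: bilin)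
    ultimately show ?thesis by blast
  qed
qed

text \<open>\<open>U\<close> is the orthogonal sum of the line of \<open>e\<close> and its
  perpendicular; the extension is the identity on the line.\<close>

lemma isom_extend:
  assumes U: "sgrp U" "e \<in> plus U" and L: "isom (perp e U) L"
  shows "\<exists>M. isom U M \<and> M e = e \<and> (\<forall>u\<in>perp e U. M u = L u)"
proof -
  define P where "P u = u - scl (B u e) e" for u
  have e: "e \<in> U" "B e e = 1" using U by (auto simp: in_plus)
  have P: "P u \<in> perp e U" if "u \<in> U" for u
    using that e U(1) by (simp add: P_def in_perp diff_left sgrp_intros)
  have P_add: "P (u + v) = P u + P v" for u v by (simp add: P_def add_left scl_add)
  have P_B: "B u v = B u e * B v e + B (P u) (P v)" for u v
    using e by (simp add: P_def bilin sym[of e v])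
  have sgp: "sgrp (perp e U)" using U by (simp add: sgrp_perp)
  have L0: "L 0 = 0" using isom_neg[OF L sgp sgrp_0[OF sgp]] isom_scl[OF L sgp sgrp_0[OF sgp], of 0]
    by simp
  define M where "M u = scl (B u e) e + L (P u)" for u
  have Lp: "L (P u) \<in> U" "B (L (P u)) e = 0" "B e (L (P u)) = 0" if "u \<in> U" for u
    using isom_in[OF L P[OF that]] by (auto simp: in_perp sym[of e])
  have "M u \<in> U" if "u \<in> U" for u using that Lp e U(1) by (simp add: M_def sgrp_intros)
  moreover have "M (u + v) = M u + M v" if "u \<in> U" "v \<in> U" for u v
    using isom_add[OF L P[OF that(1)] P[OF that(2)]] by (simp add: M_def P_add add_left scl_add)
  moreover have "B (M u) (M v) = B u v" if "u \<in> U" "v \<in> U" for u v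
    using isom_B[OF L P[OF that(1)] P[OF that(2)]] Lp that e
    by (subst P_B) (simp add: M_def bilin)
  ultimately have "isom U M" by (auto simp: isom_def)
  moreover have "M e = e" using e L0 by (simp add: M_def P_def)
  moreover have "\<forall>u\<in>perp e U. M u = L u" by (simp add: M_def P_def in_perp)
  ultimately show ?thesis by blast
qed

text \<open>A fixed plus vector \<open>a\<close> and a negated one \<open>b\<close> must be
  perpendicular. With \<open>t\<close> of norm -1 perpendicular to both, \<open>a + b + t\<close> is
  a plus vector that can be neither fixed nor negated, since it is perpendicular to neither
  \<open>a\<close> nor \<open>b\<close>.\<close>

lemma isom_fixing_points:
  assumes U: "nondeg U" "81 \<le> card U" and L: "isom U L"
    and fixed: "\<And>u. u \<in> plus U \<Longrightarrow> L u = u \<or> L u = - u"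
  shows "(\<forall>u\<in>U. L u = u) \<or> (\<forall>u\<in>U. L u = - u)"
proof -
  note sg = nondegD(1)[OF U(1)] and fin = nondegD(2)[OF U(1)]
  have "(\<forall>u\<in>plus U. L u = u) \<or> (\<forall>u\<in>plus U. L u = - u)"
  proof (rule ccontr)
    assume "\<not> ?thesis"
    then obtain a b where a: "a \<in> plus U" "L a = a" and b: "b \<in> plus U" "L b = - b"
      using fixed by blast
    have mem: "a \<in> U" "b \<in> U" "B a a = 1" "B b b = 1" using a b by (auto simp: in_plus)
    have "B a b = - B a b" using isom_B[OF L mem(1,2)] a b by simp
    then have ab: "B a b = 0" "B b a = 0" by (auto simp: gf3_self_cancel sym[of b a])
    let ?W = "perp b (perp a U)"
    have ba: "b \<in> plus (perp a U)" using b ab by (simp add: in_plus in_perp)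
    have "nondeg ?W" using nondeg_perp_plus[OF nondeg_perp_plus[OF U(1) a(1)] ba] .
    moreover have "9 \<le> card ?W"
      using card_perp[OF sg fin, of a] card_perp[of "perp a U" b] sg fin U(2)
      by (simp add: sgrp_perp finite_perp)
    ultimately obtain t where t: "t \<in> ?W" "B t t = - 1"
      using nondeg_exists_norm[of ?W "- 1"] by auto
    have tt: "B t a = 0" "B t b = 0" "B a t = 0" "B b t = 0" "t \<in> U"
      using t by (auto simp: in_perp sym[of a t] sym[of b t])
    let ?w = "a + b + t"
    have w: "?w \<in> plus U" using mem ab tt t(2) sg by (simp add: in_plus sgrp_add bilin)
    have "B (L ?w) (L a) = B ?w a" "B (L ?w) (L b) = B ?w b"
      using isom_B[OF L] w mem by (auto simp: in_plus)
    then show False using fixed[OF w] a(2) b(2) mem ab tt by (auto simp: bilin)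
  qed
  then show ?thesis
  proof
    assume *: "\<forall>u\<in>plus U. L u = u"
    have "sgrp {u \<in> U. L u = u}"
      using sg isom_add[OF L] isom_neg[OF L sg] isom_scl[OF L sg, of 0 0]
      by (auto simp: sgrp_def)
    then have "U \<subseteq> {u \<in> U. L u = u}"
      using * by (intro sgrp_spanned_by_plus[OF U]) (auto simp: in_plus)
    then show ?thesis by blast
  next
    assume *: "\<forall>u\<in>plus U. L u = - u"
    have "sgrp {u \<in> U. L u = - u}"
      using sg isom_add[OF L] isom_neg[OF L sg] isom_scl[OF L sg, of 0 0]
      by (auto simp: sgrp_def)
    then have "U \<subseteq> {u \<in> U. L u = - u}"
      using * by (intro sgrp_spanned_by_plus[OF U]) (auto simp: in_plus)
    then show ?thesis by blast
  qed
qed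

text \<open>By rigidity \<open>f\<close> and \<open>g\<close> differ by an isometry that is 1 or -1
  on the perpendicular of \<open>e\<close>, and 1 or -1 on \<open>e\<close>. Up to a global sign,
  which points do not see, it is the identity or the reflection in \<open>e\<close>.\<close>

lemma models_dichotomy:
  assumes U: "nondeg U" "243 \<le> card U" and e: "e \<in> plus U"
    and f: "models U f W R" and g: "models U g W R"
    and fg: "f e = g e" "\<And>u. u \<in> plus (perp e U) \<Longrightarrow> f u = g u"
  shows "(\<forall>u\<in>plus U. f u = g u) \<or> (\<forall>u\<in>plus U. f u = g (refl e u))"
proof -
  note sg = nondegD(1)[OF U(1)] and fin = nondegD(2)[OF U(1)]
  obtain L where L: "isom U L" "\<And>u. u \<in> plus U \<Longrightarrow> f u = g (L u)"
    using models_rigid[OF U f g] by blast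
  have pm: "L u = u \<or> L u = - u" if "u \<in> plus U" "f u = g u" for u
    using L(2)[OF that(1)] that(2) models_eq_iff[OF g isom_plus[OF L(1) that(1)] that(1)] by simp
  have eU: "e \<in> U" "B e e = 1" using e by (auto simp: in_plus)
  have Le: "L e = e \<or> L e = - e" using pm e fg by blast
  have sub: "u \<in> plus U" if "u \<in> plus (perp e U)" for u using that by (simp add: in_plus in_perp)
  have Lp: "isom (perp e U) L"
  proof -
    have "B (L u) e = 0" if "u \<in> perp e U" for u
      using isom_B[OF L(1) _ eU(1), of u] that Le by (auto simp: in_perp)
    then show ?thesis using L(1) by (auto simp: isom_def in_perp image_subset_iff)
  qed
  have cp: "81 \<le> card (perp e U)" using card_perp[OF sg fin, of e] U(2) by simp
  have K: "(\<forall>u\<in>perp e U. L u = u) \<or> (\<forall>u\<in>perp e U. L u = - u)"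
    using isom_fixing_points[OF nondeg_perp_plus[OF U(1) e] cp Lp] pm fg(2) sub by blast
  define P where "P u = u - scl (B u e) e" for u
  have P: "P u \<in> perp e U" if "u \<in> U" for u
    using that eU sg by (simp add: P_def in_perp diff_left sgrp_intros)
  have dec: "u = P u + scl (B u e) e" for u by (simp add: P_def)
  have refl: "refl e u = P u - scl (B u e) e" for u
  proof -
    have "refl e u = P u + (scl (B u e) e + scl (B u e) e)"
      using eU by (simp add: refl_def P_def)
    then show ?thesis by (simp only: add_self) simp
  qed
  have Lu: "L u = L (P u) + scl (B u e) (L e)" if "u \<in> U" for u
  proof -
    have "L (P u + scl (B u e) e) = L (P u) + L (scl (B u e) e)"
      using P[OF that] eU sg by (intro isom_add[OF L(1)]) (auto simp: in_perp sgrp_scl)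
    then show ?thesis using isom_scl[OF L(1) sg eU(1)] dec[of u] by simp
  qed
  have scl_neg: "scl c (- e) = - scl c e" for c by (simp add: scl_def)
  consider "\<forall>u\<in>U. L u = u \<or> L u = - u" | "\<forall>u\<in>U. L u = refl e u \<or> L u = - refl e u"
  proof -
    have "(\<forall>u\<in>U. L u = u) \<or> (\<forall>u\<in>U. L u = - u) \<or> (\<forall>u\<in>U. L u = refl e u) \<or> (\<forall>u\<in>U. L u = - refl e u)"
      using K Le
    proof (elim disjE)
      assume "\<forall>u\<in>perp e U. L u = u" "L e = e"
      then have "\<forall>u\<in>U. L u = u" using Lu P dec by metis
      then show ?thesis by blast
    next
      assume "\<forall>u\<in>perp e U. L u = u" "L e = - e"
      then have "\<forall>u\<in>U. L u = refl e u" using Lu P by (simp add: refl scl_neg)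
      then show ?thesis by blast
    next
      assume "\<forall>u\<in>perp e U. L u = - u" "L e = e"
      then have "\<forall>u\<in>U. L u = - refl e u" using Lu P by (simp add: refl)
      then show ?thesis by blast
    next
      assume *: "\<forall>u\<in>perp e U. L u = - u" "L e = - e"
      have "L u = - u" if "u \<in> U" for u
      proof -
        have "L u = - (P u + scl (B u e) e)" using * Lu[OF that] P[OF that] by (simp add: scl_neg)
        then show ?thesis using dec[of u] by simp
      qed
      then show ?thesis by blast
    qed
    then show ?thesis using that by blast
  qed
  then show ?thesis
  proof cases
    case 1
    have "f u = g u" if u: "u \<in> plus U" for u
    proof -
      have "L u = u \<or> L u = - u" using 1 u by (simp add: in_plus)
      then show ?thesis using L(2)[OF u] models_neg[OF g sg u] by auto
    qed
    then show ?thesis by blast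
  next
    case 2
    have "f u = g (refl e u)" if u: "u \<in> plus U" for u
    proof -
      have "refl e u \<in> plus U" using isom_plus[OF refl_isom[OF sg eU(1)] u] eU by simp
      moreover have "L u = refl e u \<or> L u = - refl e u" using 2 u by (simp add: in_plus)
      ultimately show ?thesis using L(2)[OF u] models_neg[OF g sg] by auto
    qed
    then show ?thesis by blast
  qed
qed

section \<open>Orthogonal families\<close>


definition orthogonal :: "'v list \<Rightarrow> bool" where
  "orthogonal vs \<longleftrightarrow> sorted_wrt (\<lambda>u v. B u v = 0) vs"

text \<open>A nonzero isotropic \<open>p\<close> has an isotropic partner \<open>q\<close> with
  \<open>B p q = 1\<close>, and \<open>p - q\<close>, \<open>p + q\<close> diagonalise their plane.
  The products with \<open>p\<close> serve to project other vectors off this plane.\<close>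

lemma hyperbolic_pair:
  assumes "nondeg S" "p \<in> S" "p \<noteq> 0" "B p p = 0"
  shows "\<exists>g\<in>S. \<exists>h\<in>S. B g g = 1 \<and> B h h = - 1 \<and> B g h = 0 \<and> B p g = - 1 \<and> B p h = 1 \<and> g + h = - p"
proof -
  have sg: "sgrp S" using assms by (simp add: nondegD)
  obtain s where s: "s \<in> S" "B p s \<noteq> 0" using nondeg_eq_0[OF assms(1,2)] assms(3) by blast
  define s' where "s' = scl (B p s) s"
  \<comment> \<open>The added multiple of \<open>p\<close> triples the norm of \<open>s'\<close>,
    that is, makes it 0.\<close>
  define q where "q = s' + scl (B s' s') p"
  have ps: "B p s' = 1" "B s' p = 1" using gf3_square[OF s(2)] by (simp_all add: s'_def sym[of s p])
  have q: "q \<in> S" using s assms sg by (simp add: q_def s'_def sgrp_intros)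
  have pq: "B p q = 1" "B q p = 1" using ps assms by (simp_all add: q_def bilin)
  have "B q q = B s' s' + (B s' s' + B s' s')" using ps assms by (simp add: q_def bilin)
  then have qq: "B q q = 0" by (simp add: gf3_add_self)
  have "p - q + (p + q) = - p" using add_self[of p] by simp
  then show ?thesis
    using q assms sg pq qq
    by (intro bexI[of _ "p - q"] bexI[of _ "p + q"]) (auto simp: bilin sgrp_intros)
qed

text \<open>The alternative is only possible in dimension 7, where it forces discriminant \<open>- 1\<close>.\<close>

lemma common_plus_or_family:
  assumes T: "nondeg T" "2187 \<le> card T" and e: "e \<in> plus T"
    and x: "x \<in> plus (perp e T)" and y: "y \<in> plus (perp e T)"
    and xy: "B x y \<noteq> 0" "x \<noteq> y" "x \<noteq> - y"
    and p: "p \<in> perp y (perp x (perp e T))" "B p p = 0"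
  shows "(\<exists>t. t \<in> plus (perp p (perp y (perp x (perp e T))))) \<or>
    card T < 6561 \<and> (\<exists>vs. length vs = 7 \<and> set vs \<subseteq> T \<and> orthogonal vs \<and> (\<Prod>v\<leftarrow>vs. B v v) = - 1)"
proof (rule disjCI)
  assume no: "\<not> (card T < 6561 \<and>
    (\<exists>vs. length vs = 7 \<and> set vs \<subseteq> T \<and> orthogonal vs \<and> (\<Prod>v\<leftarrow>vs. B v v) = - 1))"
  note sg = nondegD(1)[OF T(1)] and fin = nondegD(2)[OF T(1)]
  let ?U = "perp p (perp y (perp x (perp e T)))"
  have sgU: "sgrp ?U" and finU: "finite ?U" using sg fin by (simp_all add: sgrp_perp finite_perp)
  \<comment> \<open>The isotropic direction in which the perpendicular of \<open>x\<close> and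
    \<open>y\<close> is degenerate.\<close>
  define r where "r = y - scl (B x y) x"
  have mem: "e \<in> T" "x \<in> T" "y \<in> T" "p \<in> T" "B e e = 1" "B x x = 1" "B y y = 1"
    "B x e = 0" "B e x = 0" "B y e = 0" "B e y = 0" "B p e = 0" "B p x = 0" "B p y = 0"
    using e x y p by (auto simp: in_plus in_perp sym[of e x] sym[of e y])
  have rr: "r \<in> T" "B r e = 0" "B r x = 0" "B r y = 0" "B r r = 0"
    using mem sg gf3_square[OF xy(1)] by (auto simp: r_def sgrp_intros bilin sym[of y x])
  have r0: "r \<noteq> 0" using xy by (auto simp: r_def scl_def split: if_splits)
  have rad: "\<exists>i j. k = scl i r + scl j p" if k: "k \<in> rad ?U" for k
  proof -
    have k': "k \<in> T" "B k e = 0" "B k x = 0" "\<And>u. u \<in> ?U \<Longrightarrow> B k u = 0"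
      using k by (auto simp: rad_def in_perp)
    obtain i j l m where ij: "k = scl i e + scl j x + scl l y + scl m p"
      using perp_perp4[OF T(1) _ k'(1,4)] mem by blast
    have "i = 0" using k'(2) mem unfolding ij by (simp add: bilin)
    moreover have "j = - (l * B x y)"
      using k'(3) mem unfolding ij by (simp add: bilin sym[of y x] eq_neg_iff_add_eq_0)
    moreover have "scl l (u - v) = scl l u - scl l v" for u v :: 'v
      by (cases l rule: gf3_exhaust) simp_all
    ultimately have "k = scl l r + scl m p" unfolding ij r_def by (simp add: scl_scl scl_minus)
    then show ?thesis by blast
  qed
  then have "rad ?U \<subseteq> {scl i r + scl j p |i j. True}" by blast
  then have rad9: "card (rad ?U) \<le> 9"
    using card_mono[OF finite_scl_combinations(1)] card_scl_combinations order_trans by blast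
  have cU: "card T \<le> 81 * card ?U"
    using card_perp[OF sg fin, of e] card_perp[of "perp e T" x] card_perp[of "perp x (perp e T)" y]
      card_perp[of "perp y (perp x (perp e T))" p] sg fin
    by (simp add: sgrp_perp finite_perp)
  show "\<exists>t. t \<in> plus ?U"
  proof (cases "6561 \<le> card T")
    \<comment> \<open>From 3^8 elements on, \<open>?U\<close> has at least 81 > 3 * 9
      elements.\<close>
    case True
    then show ?thesis using exists_plus[OF sgU finU] rad9 cU by simp
  next
    case False
    show ?thesis
    proof (cases "\<exists>i. p = scl i r")
      \<comment> \<open>When \<open>p\<close> is a multiple of \<open>r\<close>, the radical has at
        most 3 elements, and 27 > 3 * 3.\<close>
      case True
      then obtain c where "p = scl c r" by blast
      then have "rad ?U \<subseteq> {scl i r |i. True}"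
        using rad by (metis (mono_tags, lifting) mem_Collect_eq scl_add scl_scl subsetI)
      then have "card (rad ?U) \<le> 3"
        using card_mono[OF finite_scl_combinations(2)] card_scl_multiples order_trans by blast
      then show ?thesis using exists_plus[OF sgU finU] T(2) cU by simp
    next
      case indep: False
      show ?thesis
      proof (rule ccontr)
        \<comment> \<open>The forbidden family consists of \<open>e\<close>, \<open>x\<close>, a
          vector \<open>f\<close> of norm -1 and diagonal bases of two hyperbolic planes, one
          containing \<open>p\<close> and one a modification of \<open>r\<close>; exactly three of
          its norms are -1.\<close>
        assume none: "\<nexists>t. t \<in> plus ?U"
        have "\<not> ?U \<subseteq> rad ?U"
          using card_mono[of "rad ?U" ?U] finU rad9 T(2) cU by (auto simp: rad_def)
        then obtain f where f: "f \<in> ?U" "f \<notin> rad ?U" by blast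
        have "B f f \<noteq> 0" "B f f \<noteq> 1"
          using isotropic_in_rad[OF sgU, of 1 f] f none by (auto simp: in_plus)
        then have ff: "B f f = - 1" using gf3_exhaust by blast
        have f': "f \<in> T" "B f e = 0" "B f x = 0" "B f y = 0" "B f p = 0"
            "B e f = 0" "B x f = 0" "B y f = 0" "B p f = 0"
          using f by (auto simp: in_perp sym[of e f] sym[of x f] sym[of y f] sym[of p f])
        let ?S = "perp f (perp x (perp e T))"
        have ndS: "nondeg ?S"
          using T(1) e x f' ff by (intro nondeg_perp nondeg_perp_plus) (auto simp: in_perp)
        have pS: "p \<in> ?S" using mem f' by (simp add: in_perp)
        have rS: "r \<in> ?S" using rr f' by (simp add: in_perp r_def diff_left)
        have "p \<noteq> 0" using indep scl_simps(1) by metis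
        then obtain g h where gh: "g \<in> ?S" "h \<in> ?S" "B g g = 1" "B h h = - 1" "B g h = 0"
            "B p g = - 1" "B p h = 1" "g + h = - p"
          using hyperbolic_pair[OF ndS pS _ p(2)] by blast
        let ?S2 = "perp h (perp g ?S)"
        have ndS2: "nondeg ?S2"
          using nondeg_perp[OF nondeg_perp[OF ndS gh(1)], of h] gh(2-5)
          by (simp add: in_perp[of h g] sym[of h g])
        \<comment> \<open>This multiple of \<open>p\<close> makes the sum perpendicular to
          \<open>g\<close> and to \<open>h\<close>.\<close>
        define r' where "r' = r + scl (B r g) p"
        have "B r p = 0" using mem p by (simp add: r_def diff_left sym[of y p] sym[of x p])
        then have "B r g + B r h = 0" using add_right[of r g h] unfolding gh(8) by simp
        then have rh: "B r h = - B r g" by (simp add: eq_neg_iff_add_eq_0 add.commute)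
        have "r' \<in> ?S" using rS pS nondegD(1)[OF ndS] by (simp add: r'_def sgrp_intros)
        then have r'S: "r' \<in> ?S2" using gh rh by (simp add: in_perp[of _ h] in_perp[of _ g] r'_def add_left)
        have r'r': "B r' r' = 0"
          using rr p \<open>B r p = 0\<close> by (simp add: r'_def bilin sym[of p r])
        have "r' \<noteq> 0"
        proof
          assume *: "r' = 0"
          show False
          proof (cases "B r g" rule: gf3_exhaust)
            case 0
            then show ?thesis using * r0 by (simp add: r'_def)
          next
            case 1
            then have "p = scl (- 1) r" using * by (simp add: r'_def add_eq_0_iff)
            then show ?thesis using indep by blast
          next
            case minus_1
            then have "p = scl 1 r" using * by (simp add: r'_def)
            then show ?thesis using indep by blast
          qed
        qed
        then obtain g' h' where gh': "g' \<in> ?S2" "h' \<in> ?S2" "B g' g' = 1" "B h' h' = - 1" "B g' h' = 0"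
          using hyperbolic_pair[OF ndS2 r'S _ r'r'] by blast
        let ?vs = "[h', g', h, g, f, x, e]"
        have "orthogonal ?vs"
          using gh gh' f' mem by (auto simp: orthogonal_def in_perp sym[of h g] sym[of h' g'])
        moreover have "set ?vs \<subseteq> T" using gh gh' f' mem by (auto simp: in_perp)
        moreover have "(\<Prod>v\<leftarrow>?vs. B v v) = - 1" using gh gh' ff mem by simp
        moreover have "length ?vs = 7" by simp
        ultimately show False using no False not_le by blast
      qed
    qed
  qed
qed

text \<open>Vectors of norm 1 are split off while at least 9 elements are left. Each is appended at
  the end, so the one vector whose norm is not controlled has index 0.\<close>

lemma exists_orthogonal_family:
  "nondeg U \<Longrightarrow> 3 ^ m \<le> card U \<Longrightarrow> \<exists>vs. length vs = m \<and> set vs \<subseteq> U \<and> orthogonal vs \<and>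
     (\<forall>i<m. B (vs ! i) (vs ! i) \<noteq> 0 \<and> (0 < i \<longrightarrow> B (vs ! i) (vs ! i) = 1))"
proof (induction m arbitrary: U)
  case 0
  then show ?case by (simp add: orthogonal_def)
next
  case (Suc m)
  note sg = nondegD(1)[OF Suc.prems(1)] and fin = nondegD(2)[OF Suc.prems(1)]
  show ?case
  proof (cases m)
    case 0
    have "\<exists>w\<in>U. B w w \<noteq> 0"
    proof (rule ccontr)
      assume "\<not> ?thesis"
      then have "U \<subseteq> rad U" using isotropic_in_rad[OF sg, of 1] by auto
      then have "card U \<le> 1" using Suc.prems(1) card_mono[of "{0}" U] by (auto simp: nondeg_def)
      then show False using Suc.prems(2) 0 by simp
    qed
    then obtain w where "w \<in> U" "B w w \<noteq> 0" by blast
    then show ?thesis using 0 by (intro exI[of _ "[w]"]) (simp add: orthogonal_def)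
  next
    case (Suc k)
    have "(3::nat) ^ 2 \<le> 3 ^ Suc m" using Suc by (intro power_increasing) auto
    then have "9 \<le> card U" using Suc.prems(2) by simp
    then obtain a where a: "a \<in> U" "B a a = 1"
      using nondeg_exists_norm[OF Suc.prems(1), of 1] by auto
    have "3 ^ m \<le> card (perp a U)" using card_perp[OF sg fin, of a] Suc.prems(2) by simp
    then obtain vs where vs: "length vs = m" "set vs \<subseteq> perp a U" "orthogonal vs"
        "\<forall>i<m. B (vs ! i) (vs ! i) \<noteq> 0 \<and> (0 < i \<longrightarrow> B (vs ! i) (vs ! i) = 1)"
      using Suc.IH[of "perp a U"] nondeg_perp[OF Suc.prems(1) a(1)] a(2) by auto
    then show ?thesis using a
      by (intro exI[of _ "vs @ [a]"])
        (auto simp: orthogonal_def sorted_wrt_append in_perp nth_append less_Suc_eq)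
  qed
qed

lemma sum_left: "B (\<Sum>j\<in>J. f j) w = (\<Sum>j\<in>J. B (f j) w)"
  by (induction J rule: infinite_finite_induct) (auto simp: add_left)

lemma sum_right: "B w (\<Sum>j\<in>J. f j) = (\<Sum>j\<in>J. B w (f j))"
  by (simp add: sym[of w] sum_left)

lemma orthogonal_nth:
  assumes "orthogonal vs" "i < length vs" "j < length vs" "i \<noteq> j"
  shows "B (vs ! i) (vs ! j) = 0"
proof (cases "i < j")
  case True
  then show ?thesis using assms by (simp add: orthogonal_def sorted_wrt_iff_nth_less)
next
  case False
  then have "B (vs ! j) (vs ! i) = 0"
    using assms by (auto simp: orthogonal_def sorted_wrt_iff_nth_less)
  then show ?thesis by (simp add: sym)
qed

end

section \<open>Gluing local charts\<close>

text \<open>Both images are the quotient of \<open>A\<close> by the same equivalence.\<close>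

lemma card_image_same_kernel:
  assumes "\<And>u v. u \<in> A \<Longrightarrow> v \<in> A \<Longrightarrow> f u = f v \<longleftrightarrow> g u = g v"
  shows "card (f ` A) = card (g ` A)"
proof -
  have "bij_betw (\<lambda>y. g (inv_into A f y)) (f ` A) (g ` A)"
  proof (rule bij_betwI')
    fix x y assume xy: "x \<in> f ` A" "y \<in> f ` A"
    then show "g (inv_into A f x) = g (inv_into A f y) \<longleftrightarrow> x = y"
      using assms[of "inv_into A f x" "inv_into A f y"] by (simp add: inv_into_into f_inv_into_f)
  next
    fix x assume "x \<in> f ` A"
    then show "g (inv_into A f x) \<in> g ` A" by (simp add: inv_into_into)
  next
    fix y assume "y \<in> g ` A"
    then obtain u where u: "u \<in> A" "y = g u" by blast
    then have "g (inv_into A f (f u)) = g u"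
      using assms[of "inv_into A f (f u)" u] by (simp add: inv_into_into f_inv_into_f)
    then show "\<exists>x\<in>f ` A. y = g (inv_into A f x)" using u by (metis imageI)
  qed
  then show ?thesis by (rule bij_betw_same_card)
qed

text \<open>The assumption \<open>common\<close> holds all that the gluing has to know about the
  discriminant; \<open>common_plus_or_family\<close> is there to supply it.\<close>

locale local_sigma = gf3_form B for B :: "'v::ab_group_add \<Rightarrow> 'v \<Rightarrow> gf3" +
  fixes T :: "'v set" and e :: 'v and V :: "'a set" and E :: "'a \<Rightarrow> 'a \<Rightarrow> bool"
  assumes T: "nondeg T" "2187 \<le> card T" and e: "e \<in> plus T"
    and common: "\<And>x y p. x \<in> plus (perp e T) \<Longrightarrow> y \<in> plus (perp e T) \<Longrightarrow> B x y \<noteq> 0 \<Longrightarrow>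
      p \<in> perp y (perp x (perp e T)) \<Longrightarrow> B p p = 0 \<Longrightarrow> x \<noteq> y \<Longrightarrow> x \<noteq> - y \<Longrightarrow>
      \<exists>t. t \<in> plus (perp p (perp y (perp x (perp e T))))"
    and graph: "simple_graph V E" "connected_graph V E"
    and loc: "\<And>v. v \<in> V \<Longrightarrow> \<exists>f. models (perp e T) f (nbhd V E v) E"
begin

abbreviation "Te \<equiv> perp e T"

lemma sg: "sgrp T" and fin: "finite T"
  using T by (simp_all add: nondegD)

lemma e': "e \<in> T" "B e e = 1"
  using e by (simp_all add: in_plus)

lemma adj: "E u v \<Longrightarrow> u \<in> V" "E u v \<Longrightarrow> v \<in> V" "E u v \<Longrightarrow> E v u"
  using graph(1) by (auto simp: simple_graph_def)

lemma in_nbhd: "w \<in> nbhd V E v \<longleftrightarrow> E v w"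
  using adj by (auto simp: nbhd_def)

lemma card_Te: "729 \<le> card Te" "finite Te" "sgrp Te"
  using card_perp[OF sg fin, of e] T(2) by (simp_all add: sg fin finite_perp sgrp_perp)

text \<open>The radical of the perpendicular of \<open>e\<close>, \<open>y\<close>, \<open>z\<close>
  lies in the span of the projections of \<open>y\<close> and \<open>z\<close> off \<open>e\<close>:
  at most 9 elements against at least 81.\<close>

lemma common_plus:
  assumes "y \<in> plus T" "z \<in> plus T"
  shows "\<exists>x. x \<in> plus Te \<and> B y x = 0 \<and> B z x = 0"
proof -
  let ?U = "perp z (perp y Te)"
  have mem: "y \<in> T" "z \<in> T" using assms by (auto simp: in_plus)
  have "rad ?U \<subseteq> {scl i (y - scl (B y e) e) + scl j (z - scl (B z e) e) |i j. True}"
  proof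
    fix k assume k: "k \<in> rad ?U"
    then have "k \<in> T" "B k e = 0" "\<And>u. u \<in> perp 0 ?U \<Longrightarrow> B k u = 0"
      by (auto simp: rad_def in_perp)
    moreover from perp_perp4[OF T(1) _ this(1) this(3)]
    obtain i j l m where ij: "k = scl i e + scl j y + scl l z + scl m 0"
      using mem e' sgrp_0[OF sg] by blast
    ultimately have "i + (j * B y e + l * B z e) = 0"
      using e' by (simp add: bilin add.assoc)
    then have i: "i = - (j * B y e) + - (l * B z e)"
      by (metis add_eq_0_iff2 minus_add_distrib)
    have scl_diff: "scl c (u - v) = scl c u - scl c v" for c and u v :: 'v
      by (cases c rule: gf3_exhaust) simp_all
    have "k = scl j (y - scl (B y e) e) + scl l (z - scl (B z e) e)"
      unfolding ij i scl_add scl_diff scl_scl scl_minus by simp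
    then show "k \<in> {scl i (y - scl (B y e) e) + scl j (z - scl (B z e) e) |i j. True}" by blast
  qed
  then have "card (rad ?U) \<le> 9"
    using card_mono[OF finite_scl_combinations(1)] card_scl_combinations order_trans by blast
  moreover have "81 \<le> card ?U"
    using card_perp[OF card_Te(3,2), of y] card_perp[of "perp y Te" z] card_Te
    by (simp add: sgrp_perp finite_perp)
  ultimately obtain x where "x \<in> plus ?U"
    using exists_plus[of ?U] card_Te by (auto simp: sgrp_perp finite_perp)
  then show ?thesis by (auto simp: in_plus in_perp sym)
qed

text \<open>Isometries are transitive on plus vectors, so a model on the perpendicular of
  \<open>e\<close> can be carried to that of \<open>x\<close>.\<close>

lemma loc_at:
  assumes x: "x \<in> plus T" and v: "v \<in> V"
  shows "\<exists>f. models (perp x T) f (nbhd V E v) E"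
proof -
  obtain f where f: "models Te f (nbhd V E v) E" using loc v by blast
  obtain S where S: "isom T S" "S x = e" using isom_transitive[OF sg x e] by blast
  have xT: "x \<in> T" using x by (simp add: in_plus)
  have BS: "B (S u) e = B u x" if "u \<in> T" for u using isom_B[OF S(1) that xT] S(2) by simp
  have "models (perp x T) (f \<circ> S) (nbhd V E v) E"
  proof (rule models_comp[OF gf3_form_axioms f])
    show "inj_on S (perp x T)" using isom_inj[OF S(1) T(1)] by (rule inj_on_subset) (auto simp: in_perp)
    show "S ` perp x T = Te"
    proof
      show "S ` perp x T \<subseteq> Te" using isom_in[OF S(1)] BS by (auto simp: in_perp)
      show "Te \<subseteq> S ` perp x T"
      proof
        fix w assume w: "w \<in> Te"
        then obtain u where u: "u \<in> T" "w = S u"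
          using isom_onto[OF S(1) T(1)] by (auto simp: in_perp)
        then show "w \<in> S ` perp x T" using w BS by (auto simp: in_perp)
      qed
    qed
    show "sgrp (perp x T)" using sg by (simp add: sgrp_perp)
  qed (use isom_add[OF S(1)] isom_B[OF S(1)] in \<open>auto simp: in_perp\<close>)
  then show ?thesis by blast
qed

end

section \<open>Charts at the neighbours of a base vertex\<close>

locale base_chart = local_sigma +
  fixes v0 :: 'b and eta :: "'a \<Rightarrow> 'b"
  assumes v0: "v0 \<in> V" and eta: "models (perp e T) eta (nbhd V E v0) E"
begin

text \<open>The base vertex \<open>v0\<close> is named by \<open>e\<close>. A chart at
  \<open>x\<close> names the neighbours of \<open>eta x\<close> and must keep the names that
  \<open>eta\<close> gives to the common neighbours of \<open>v0\<close> and
  \<open>eta x\<close>.\<close>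

definition chart :: "'a \<Rightarrow> ('a \<Rightarrow> 'b) \<Rightarrow> bool" where
  "chart x f \<longleftrightarrow> models (perp x T) f (nbhd V E (eta x)) E \<and> f e = v0 \<and>
     (\<forall>u\<in>plus (perp x Te). f u = eta u)"

lemma chart_models: "chart x f \<Longrightarrow> models (perp x T) f (nbhd V E (eta x)) E"
  and chart_e: "chart x f \<Longrightarrow> f e = v0"
  and chart_eta: "chart x f \<Longrightarrow> u \<in> plus (perp x Te) \<Longrightarrow> f u = eta u"
  by (simp_all add: chart_def)

lemma plus_Te:
  assumes "x \<in> plus Te"
  shows "x \<in> plus T" "B x e = 0" "B e x = 0" "e \<in> plus (perp x T)" "E v0 (eta x)" "eta x \<in> V"
  using assms e' models_in[OF eta assms] adj by (auto simp: in_plus in_perp in_nbhd sym[of e x])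

text \<open>An arbitrary model at \<open>eta x\<close> is corrected twice: transitivity makes
  \<open>e\<close> name \<open>v0\<close>; then rigidity on the common neighbourhood gives an
  isometry, which is extended by fixing \<open>e\<close>.\<close>

lemma chart_exists:
  assumes x: "x \<in> plus Te"
  shows "\<exists>f. chart x f"
proof -
  note x' = plus_Te[OF x]
  have nd: "nondeg (perp x T)" using nondeg_perp_plus T x' by blast
  obtain f1 where f1: "models (perp x T) f1 (nbhd V E (eta x)) E"
    using loc_at[OF x'(1,6)] by blast
  have "v0 \<in> nbhd V E (eta x)" using x' adj by (simp add: in_nbhd)
  then obtain y where y: "y \<in> plus (perp x T)" "f1 y = v0"
    using models_image[OF f1] by (metis (no_types, lifting) imageE)
  obtain L1 where L1: "isom (perp x T) L1" "L1 e = y"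
    using isom_transitive[OF sgrp_perp[OF sg] x'(4) y(1)] by blast
  define f2 where "f2 = f1 \<circ> L1"
  have f2: "models (perp x T) f2 (nbhd V E (eta x)) E" "f2 e = v0"
    using models_isom[OF f1 nd L1(1)] L1(2) y(2) by (simp_all add: f2_def)
  let ?K = "perp e (perp x T)" and ?W = "{w. E v0 w \<and> E (eta x) w}"
  have K: "?K = perp x Te" by (rule perp_commute)
  have "models ?K f2 ?W E"
    using models_perp[OF f2(1) x'(4)] f2(2) by (simp add: in_nbhd conj_commute)
  moreover have "models ?K eta ?W E"
    using models_perp[OF eta x] K by (simp add: in_nbhd)
  moreover have "nondeg ?K" using nondeg_perp_plus[OF nd x'(4)] .
  moreover have "243 \<le> card ?K" using card_perp[OF card_Te(3,2), of x] card_Te(1) K by simp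
  ultimately obtain L where L: "isom ?K L" "\<And>u. u \<in> plus ?K \<Longrightarrow> eta u = f2 (L u)"
    using models_rigid[of ?K eta ?W E f2] by blast
  obtain M where M: "isom (perp x T) M" "M e = e" "\<And>u. u \<in> ?K \<Longrightarrow> M u = L u"
    using isom_extend[OF sgrp_perp[OF sg] x'(4) L(1)] by blast
  have "chart x (f2 \<circ> M)"
    unfolding chart_def using models_isom[OF f2(1) nd M(1)] f2(2) M L(2) K by (auto simp: in_plus)
  then show ?thesis by blast
qed

text \<open>Up to sign, the vectors \<open>e + p\<close> with such \<open>p\<close> are the common
  arguments of the charts at \<open>x\<close> and \<open>y\<close> that are not perpendicular to
  \<open>e\<close>, so those on which \<open>eta\<close> does not decide.\<close>

definition isos :: "'a \<Rightarrow> 'a \<Rightarrow> 'a set" where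
  "isos x y = {p \<in> perp y (perp x Te). B p p = 0}"

definition agree :: "'a \<Rightarrow> ('a \<Rightarrow> 'b) \<Rightarrow> 'a \<Rightarrow> ('a \<Rightarrow> 'b) \<Rightarrow> bool" where
  "agree x f y g \<longleftrightarrow> (\<forall>p\<in>isos x y. f (e + p) = g (e + p))"

definition twisted :: "'a \<Rightarrow> ('a \<Rightarrow> 'b) \<Rightarrow> 'a \<Rightarrow> ('a \<Rightarrow> 'b) \<Rightarrow> bool" where
  "twisted x f y g \<longleftrightarrow> (\<forall>p\<in>isos x y. f (e + p) = g (e - p))"

lemma isos_commute: "isos x y = isos y x"
  by (simp add: isos_def perp_commute)

lemma isos_neg: "p \<in> isos x y \<Longrightarrow> - p \<in> isos x y"
  using sg by (auto simp: isos_def in_perp sgrp_neg)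

lemma isos_plus:
  assumes "p \<in> isos x y" "x \<in> plus Te" "y \<in> plus Te"
  shows "e + p \<in> plus (perp x T)" "e - p \<in> plus (perp x T)"
    "e + p \<in> plus (perp y (perp x T))"
  using assms e' sg
  by (auto simp: isos_def in_perp in_plus bilin sgrp_intros sym[of e p] sym[of e x] sym[of e y])

text \<open>Makes \<open>agree\<close> and \<open>twisted\<close> exclusive as soon as a nonzero
  \<open>p\<close> is available.\<close>

lemma chart_separates:
  assumes "chart x f" "p \<in> isos x y" "p \<noteq> 0" "x \<in> plus Te" "y \<in> plus Te"
  shows "f (e + p) \<noteq> f (e - p)"
proof
  assume "f (e + p) = f (e - p)"
  then have "e + p = e - p \<or> e + p = - (e - p)"
    using models_eq_iff[OF chart_models[OF assms(1)]] isos_plus[OF assms(2,4,5)] by blast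
  then have "p + p = 0 \<or> e + e = 0" by (auto simp: algebra_simps eq_neg_iff_add_eq_0)
  then have "p = 0 \<or> e = 0" by (simp add: add_self)
  then show False using assms(3) e' by auto
qed

lemma refl_isos:
  assumes "p \<in> isos x y"
  shows "refl e (e + p) = - (e - p)" "refl e (e - p) = - (e + p)"
proof -
  have "B p e = 0" using assms by (simp add: isos_def in_perp)
  then have "refl e (e + p) = (e + e) + p" "refl e (e - p) = (e + e) - p"
    using e' by (simp_all add: refl_def bilin algebra_simps)
  then show "refl e (e + p) = - (e - p)" "refl e (e - p) = - (e + p)"
    by (simp_all add: add_self)
qed

text \<open>This is the second chart at \<open>x\<close>, with \<open>e + p\<close> and
  \<open>e - p\<close> exchanged.\<close>

lemma chart_refl:
  assumes "chart x f" "x \<in> plus Te"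
  shows "chart x (f \<circ> refl e)"
proof -
  note x' = plus_Te[OF assms(2)]
  have nd: "nondeg (perp x T)" using nondeg_perp_plus T x' by blast
  have "isom (perp x T) (refl e)"
    using refl_isom[OF sgrp_perp[OF sg], of e x] x'(4) by (simp add: in_plus)
  then have "models (perp x T) (f \<circ> refl e) (nbhd V E (eta x)) E"
    using models_isom[OF chart_models[OF assms(1)] nd] by blast
  moreover have "refl e e = - e" using e' add_self[of e] by (simp add: refl_def)
  moreover have "f (- e) = f e"
    using models_neg[OF chart_models[OF assms(1)] sgrp_perp[OF sg] x'(4)] .
  moreover have "refl e u = u" if "u \<in> plus (perp x Te)" for u
    using that by (simp add: refl_def in_plus in_perp)
  ultimately show ?thesis using assms(1) by (simp add: chart_def)
qed

text \<open>Both charts restrict to models of one graph on one space: the common neighbourhood of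
  \<open>eta x\<close> and \<open>eta y\<close>, or the whole neighbourhood if these vertices
  coincide. So \<open>models_dichotomy\<close> applies.\<close>

lemma dichotomy_adjacent:
  assumes x: "x \<in> plus Te" and y: "y \<in> plus Te" and f: "chart x f" and g: "chart y g"
    and xy: "B x y = 0 \<or> x = y \<or> x = - y"
  shows "agree x f y g \<or> twisted x f y g"
proof -
  note x' = plus_Te[OF x] and y' = plus_Te[OF y]
  let ?U = "perp y (perp x T)"
  have nd: "nondeg (perp x T)" using nondeg_perp_plus T x' by blast
  have cx: "729 \<le> card (perp x T)" using card_perp[OF sg fin, of x] T(2) by simp
  have "\<exists>U W. nondeg U \<and> 243 \<le> card U \<and> ?U \<subseteq> U \<and> U \<subseteq> perp x T \<and> U \<subseteq> perp y T \<and>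
     e \<in> plus U \<and> models U f W E \<and> models U g W E"
  proof (cases "B x y = 0")
    case True
    then have yx: "y \<in> plus (perp x T)" "x \<in> plus (perp y T)" "y \<in> plus (perp x Te)"
        "x \<in> plus (perp y Te)"
      using x y by (auto simp: in_plus in_perp sym[of y x])
    have "models ?U f {w. E (eta x) w \<and> E (eta y) w} E"
      using models_perp[OF chart_models[OF f] yx(1)] chart_eta[OF f yx(3)] by (simp add: in_nbhd)
    moreover have "models ?U g {w. E (eta x) w \<and> E (eta y) w} E"
      using models_perp[OF chart_models[OF g] yx(2)] chart_eta[OF g yx(4)]
      by (simp add: in_nbhd conj_commute perp_commute[of x y])
    moreover have "nondeg ?U" using nondeg_perp_plus[OF nd yx(1)] .
    moreover have "243 \<le> card ?U"
      using card_perp[of "perp x T" y] cx sg fin by (simp add: sgrp_perp finite_perp)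
    moreover have "e \<in> plus ?U" "?U \<subseteq> perp x T" "?U \<subseteq> perp y T"
      using x'(4) y'(4) by (auto simp: in_plus in_perp)
    ultimately show ?thesis by blast
  next
    case False
    then have "perp y T = perp x T" "eta y = eta x"
      using xy models_neg[OF eta card_Te(3) x] models_neg[OF eta card_Te(3) y] by auto
    moreover from this have "?U = perp x T" by (auto simp: perp_def)
    ultimately show ?thesis
      using nd cx x'(4) chart_models[OF f] chart_models[OF g] by (intro exI[of _ "perp x T"]) auto
  qed
  then obtain U W where U: "nondeg U" "243 \<le> card U" "?U \<subseteq> U" "U \<subseteq> perp x T" "U \<subseteq> perp y T"
      "e \<in> plus U" "models U f W E" "models U g W E" by blast
  have "f u = g u" if "u \<in> plus (perp e U)" for u
  proof -
    have "u \<in> plus (perp x Te)" "u \<in> plus (perp y Te)"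
      using that U(4,5) by (auto simp: in_plus in_perp)
    then show ?thesis using chart_eta f g by metis
  qed
  then have "(\<forall>u\<in>plus U. f u = g u) \<or> (\<forall>u\<in>plus U. f u = g (refl e u))"
    using models_dichotomy[OF U(1,2,6-8)] chart_e f g by metis
  moreover have "e + p \<in> plus U" if "p \<in> isos x y" for p
    using isos_plus(3)[OF that x y] U(3) by (auto simp: in_plus)
  moreover have "g (refl e (e + p)) = g (e - p)" if "p \<in> isos x y" for p
    using refl_isos(1)[OF that] models_neg[OF chart_models[OF g] sgrp_perp[OF sg]]
      isos_plus(2)[of p y x] that x y by (simp add: isos_commute del: minus_diff_eq)
  ultimately show ?thesis unfolding agree_def twisted_def by metis
qed

text \<open>For non-perpendicular \<open>x\<close> and \<open>y\<close> the isotropic vector \<open>y - (x,y)x\<close> lies in the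
  radical of \<open>{x,y}\<close>-perp, so the sign at any other isotropic \<open>p\<close> can be compared with
  the sign at this vector through a plus point perpendicular to \<open>x\<close>, \<open>y\<close> and \<open>p\<close>.\<close>

lemma dichotomy:
  assumes x: "x \<in> plus Te" and y: "y \<in> plus Te" and f: "chart x f" and g: "chart y g"
  shows "agree x f y g \<or> twisted x f y g"
proof (cases "B x y = 0 \<or> x = y \<or> x = - y")
  case True
  then show ?thesis using dichotomy_adjacent[OF assms] by blast
next
  case False
  define r where "r = y - scl (B x y) x"
  have nz: "B x y \<noteq> 0" using False by simp
  have mem: "x \<in> Te" "y \<in> Te" "B x x = 1" "B y y = 1" using x y by (auto simp: in_plus)
  have rI: "r \<in> isos x y"
    using mem card_Te(3) gf3_square[OF nz] sgrp_perp[OF card_Te(3)]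
    by (simp add: isos_def in_perp[of _ y] in_perp[of _ x] r_def sgrp_intros bilin sym[of y x])
  have r0: "r \<noteq> 0" using False nz by (auto simp: r_def scl_def split: if_splits)
  \<comment> \<open>The comparison passes through a chart at a plus point \<open>t\<close>
    perpendicular to \<open>x\<close>, \<open>y\<close>, \<open>p\<close> and \<open>r\<close>, so
    the same alternative holds at \<open>p\<close> and at \<open>r\<close>.\<close>
  have same: "(f (e + p) = g (e + p) \<and> f (e + r) = g (e + r)) \<or>
      (f (e + p) = g (e - p) \<and> f (e + r) = g (e - r))" if p: "p \<in> isos x y" for p
  proof -
    have "p \<in> perp y (perp x Te)" "B p p = 0" using p by (auto simp: isos_def)
    then obtain t where "t \<in> plus (perp p (perp y (perp x Te)))"
      using common[OF x y nz] False by blast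
    then have t: "t \<in> plus Te" "B t p = 0" "B t x = 0" "B t y = 0"
      by (auto simp: in_plus in_perp)
    have "B p t = 0" "B r t = 0" using t by (simp_all add: r_def diff_left sym[of p t] sym[of x t] sym[of y t])
    then have I: "q \<in> isos x t" "q \<in> isos t y" if "q = p \<or> q = r" for q
      using p rI that by (auto simp: isos_def in_perp)
    obtain h where h: "chart t h" using chart_exists t by blast
    have 1: "agree x f t h \<or> twisted x f t h"
      using dichotomy_adjacent[OF x t(1) f h] t by (simp add: sym)
    have 2: "agree t h y g \<or> twisted t h y g"
      using dichotomy_adjacent[OF t(1) y h g] t by (simp add: sym)
    have neg: "h (e - q) = g (e + q)" if "twisted t h y g" "q = p \<or> q = r" for q
      using that isos_neg[OF I(2)[OF that(2)]] by (auto simp: twisted_def)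
    have neg': "h (e - q) = g (e - q)" if "agree t h y g" "q = p \<or> q = r" for q
      using that isos_neg[OF I(2)[OF that(2)]] by (auto simp: agree_def)
    have pos: "h (e + q) = g (e + q)" if "agree t h y g" "q = p \<or> q = r" for q
      using that I(2)[OF that(2)] by (auto simp: agree_def)
    have pos': "h (e + q) = g (e - q)" if "twisted t h y g" "q = p \<or> q = r" for q
      using that I(2)[OF that(2)] by (auto simp: twisted_def)
    have fh: "f (e + q) = h (e + q)" if "agree x f t h" "q = p \<or> q = r" for q
      using that I(1)[OF that(2)] by (auto simp: agree_def)
    have fh': "f (e + q) = h (e - q)" if "twisted x f t h" "q = p \<or> q = r" for q
      using that I(1)[OF that(2)] by (auto simp: twisted_def)
    from 1 2 show ?thesis
      by (elim disjE) (simp_all add: fh fh' pos pos' neg neg')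
  qed
  show ?thesis
  proof (cases "f (e + r) = g (e + r)")
    case True
    then have "f (e + r) \<noteq> g (e - r)"
      using chart_separates[OF g, of r x] rI r0 x y by (simp add: isos_commute)
    then show ?thesis using same by (auto simp: agree_def)
  next
    case False
    then show ?thesis using same by (auto simp: twisted_def)
  qed
qed

text \<open>At a nonzero isotropic \<open>p\<close> perpendicular to \<open>e\<close>,
  \<open>x\<close>, \<open>y\<close> and \<open>z\<close> the two agreements compose, which rules
  out \<open>twisted\<close>.\<close>

lemma agree_trans:
  assumes x: "x \<in> plus Te" and y: "y \<in> plus Te" and z: "z \<in> plus Te"
    and f: "chart x f" and g: "chart y g" and h: "chart z h"
    and fg: "agree x f y g" and gh: "agree y g z h"
  shows "agree x f z h"
proof -
  let ?U = "perp z (perp y (perp x Te))"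
  have "27 \<le> card ?U"
    using card_perp[OF card_Te(3,2), of x] card_perp[of "perp x Te" y]
      card_perp[of "perp y (perp x Te)" z] card_Te
    by (simp add: sgrp_perp finite_perp)
  then obtain p where p: "p \<in> ?U" "p \<noteq> 0" "B p p = 0"
    using exists_isotropic[of ?U] card_Te by (auto simp: sgrp_perp finite_perp)
  then have I: "p \<in> isos x y" "p \<in> isos y z" "p \<in> isos x z" "p \<in> isos z x"
    by (auto simp: isos_def in_perp)
  have "f (e + p) = h (e + p)" using fg gh I by (simp add: agree_def)
  then have "f (e + p) \<noteq> h (e - p)" using chart_separates[OF h I(4) p(2) z x] by simp
  then have "\<not> twisted x f z h" using I(3) by (auto simp: twisted_def)
  then show ?thesis using dichotomy[OF x z f h] by blast
qed

lemma agree_sym: "agree x f y g \<Longrightarrow> agree y g x f"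
  by (simp add: agree_def isos_commute)

text \<open>Each chart is compared with one fixed chart and composed with the reflection in
  \<open>e\<close> if the two do not agree.\<close>

lemma consistent_charts:
  "\<exists>c. (\<forall>x\<in>plus Te. chart x (c x)) \<and> (\<forall>x\<in>plus Te. \<forall>y\<in>plus Te. agree x (c x) y (c y))"
proof -
  have "nondeg Te" using nondeg_perp_plus T e by blast
  then obtain a where a: "a \<in> plus Te"
    using nondeg_exists_norm[of Te 1] card_Te by (auto simp: in_plus)
  then obtain f where f: "chart a f" using chart_exists by blast
  have "\<exists>g. chart x g \<and> agree x g a f" if x: "x \<in> plus Te" for x
  proof -
    obtain g where g: "chart x g" using chart_exists x by blast
    show ?thesis
    proof (cases "agree x g a f")
      case False
      then have tw: "twisted x g a f" using dichotomy[OF x a g f] by blast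
      have "(g \<circ> refl e) (e + p) = f (e + p)" if p: "p \<in> isos x a" for p
      proof -
        have "(g \<circ> refl e) (e + p) = g (e - p)"
          using refl_isos(1)[OF p] isos_plus(2)[OF p x a]
            models_neg[OF chart_models[OF g] sgrp_perp[OF sg]] by (simp del: minus_diff_eq)
        also have "\<dots> = f (e + p)" using tw isos_neg[OF p] by (auto simp: twisted_def)
        finally show ?thesis .
      qed
      then show ?thesis using chart_refl[OF g x] by (auto simp: agree_def)
    qed (use g in blast)
  qed
  then obtain c where c: "\<forall>x\<in>plus Te. chart x (c x) \<and> agree x (c x) a f" by metis
  then have "agree x (c x) y (c y)" if "x \<in> plus Te" "y \<in> plus Te" for x y
    using agree_trans[OF that(1) a that(2) _ f] agree_sym that by blast
  then show ?thesis using c by blast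
qed

theorem models_T: "\<exists>F. models T F V E"
proof -
  obtain c where c: "\<And>x. x \<in> plus Te \<Longrightarrow> chart x (c x)"
      "\<And>x y. x \<in> plus Te \<Longrightarrow> y \<in> plus Te \<Longrightarrow> agree x (c x) y (c y)"
    using consistent_charts by blast
  \<comment> \<open>The value is given by \<open>eta\<close> if \<open>z\<close> is perpendicular to
    \<open>e\<close>; otherwise \<open>z\<close> is, up to sign, \<open>e + p\<close> with
    \<open>p\<close> isotropic, where the charts agree.\<close>
  have indep: "c x z = c y z"
    if x: "x \<in> plus Te" "B z x = 0" and y: "y \<in> plus Te" "B z y = 0" and z: "z \<in> plus T" for x y z
  proof -
    note cx = c(1)[OF x(1)] and cy = c(1)[OF y(1)]
    have zx: "z \<in> plus (perp x T)" and zy: "z \<in> plus (perp y T)"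
      using x y z by (auto simp: in_plus in_perp)
    note negx = models_neg[OF chart_models[OF cx] sgrp_perp[OF sg]]
      and negy = models_neg[OF chart_models[OF cy] sgrp_perp[OF sg]]
    have *: "c x w = c y w" if w: "w \<in> plus T" "B w x = 0" "B w y = 0" "B w e = 1" for w
    proof -
      have "w - e \<in> isos x y"
        using w e' sg plus_Te[OF x(1)] plus_Te[OF y(1)]
        by (auto simp: isos_def in_perp in_plus bilin sgrp_diff sym[of e w])
      then have "c x (e + (w - e)) = c y (e + (w - e))"
        using c(2)[OF x(1) y(1)] unfolding agree_def by blast
      then show ?thesis by simp
    qed
    show ?thesis
    proof (cases "B z e" rule: gf3_exhaust)
      case 0
      then have "z \<in> plus (perp x Te)" "z \<in> plus (perp y Te)" using zx zy by (auto simp: in_plus in_perp)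
      then show ?thesis using chart_eta[OF cx] chart_eta[OF cy] by simp
    next
      case 1
      then show ?thesis using * x y z by blast
    next
      case minus_1
      then have "c x (- z) = c y (- z)" using x y z sg by (intro *) auto
      then show ?thesis using negx[OF zx] negy[OF zy] by simp
    qed
  qed
  define F where "F z = c (SOME x. x \<in> plus Te \<and> B z x = 0) z" for z
  have F: "F z = c x z" if "x \<in> plus Te" "B z x = 0" "z \<in> plus T" for x z
  proof -
    have "(SOME x. x \<in> plus Te \<and> B z x = 0) \<in> plus Te \<and> B z (SOME x. x \<in> plus Te \<and> B z x = 0) = 0"
      using that by (intro someI) auto
    then show ?thesis unfolding F_def using indep that by blast
  qed
  \<comment> \<open>A plus point \<open>x\<close> perpendicular to \<open>e\<close>,
    \<open>y\<close> and \<open>z\<close> puts both vectors into one chart, where everything can be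
    read off.\<close>
  have pair: "(F y = F z \<longleftrightarrow> y = z \<or> y = - z) \<and> (E (F y) (F z) \<longleftrightarrow> B y z = 0) \<and> F y \<in> V"
    if yz: "y \<in> plus T" "z \<in> plus T" for y z
  proof -
    obtain x where x: "x \<in> plus Te" "B y x = 0" "B z x = 0" using common_plus[OF yz] by blast
    then have "y \<in> plus (perp x T)" "z \<in> plus (perp x T)"
      using yz by (auto simp: in_plus in_perp)
    note yzx = this and m = chart_models[OF c(1)[OF x(1)]]
    show ?thesis
      unfolding F[OF x(1,2) yz(1)] F[OF x(1,3) yz(2)]
      using models_eq_iff[OF m yzx] models_adj_iff[OF m yzx] models_in[OF m yzx(1)] adj
      by (auto simp: in_nbhd)
  qed
  \<comment> \<open>The points perpendicular to \<open>z\<close> are as many as the neighbours of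
    \<open>F z\<close> and go injectively into them, so every neighbour is reached. Connectedness
    will then give surjectivity.\<close>
  have closed: "w \<in> F ` plus T" if z: "z \<in> plus T" and w: "E (F z) w" for z w
  proof -
    obtain f where f: "models (perp z T) f (nbhd V E (F z)) E" using loc_at pair z by blast
    let ?A = "plus (perp z T)"
    have sub: "?A \<subseteq> plus T" by (auto simp: in_plus in_perp)
    have "card (F ` ?A) = card (f ` ?A)"
    proof (rule card_image_same_kernel)
      fix u v assume "u \<in> ?A" "v \<in> ?A"
      then show "F u = F v \<longleftrightarrow> f u = f v"
        using models_eq_iff[OF f] pair sub by blast
    qed
    then have "card (F ` ?A) = card (nbhd V E (F z))" using models_image[OF f] by simp
    moreover have "F ` ?A \<subseteq> nbhd V E (F z)"
    proof
      fix w assume "w \<in> F ` ?A"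
      then obtain u where u: "u \<in> ?A" "w = F u" by blast
      then have "B z u = 0" by (simp add: in_plus in_perp sym)
      then show "w \<in> nbhd V E (F z)" using pair[of z u] z u sub by (auto simp: in_nbhd)
    qed
    moreover have "finite (nbhd V E (F z))"
      unfolding models_image[OF f, symmetric] using fin by (simp add: plus_def finite_perp)
    ultimately have "F ` ?A = nbhd V E (F z)" by (metis card_subset_eq)
    then have "w \<in> F ` ?A" using w by (simp add: in_nbhd)
    then show ?thesis using sub by blast
  qed
  have "F ` plus T = V"
  proof
    show "F ` plus T \<subseteq> V" using pair by blast
    show "V \<subseteq> F ` plus T"
    proof
      fix v assume v: "v \<in> V"
      have "F e \<in> V" using pair e by blast
      then have "(\<lambda>x y. x \<in> V \<and> y \<in> V \<and> E x y)\<^sup>*\<^sup>* (F e) v"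
        using v graph(2) by (simp add: connected_graph_def)
      then show "v \<in> F ` plus T"
        by induction (use e closed in blast)+
    qed
  qed
  then have "models T F V E" using pair unfolding models_def by blast
  then show ?thesis by blast
qed

end

section \<open>Coordinates\<close>

text \<open>Vectors of all lengths share one type, so \<open>coords n\<close> is literally a
  subspace of \<open>coords (n + 1)\<close>.\<close>

definition coords :: "nat \<Rightarrow> (nat \<Rightarrow> gf3) set" where
  "coords m = {v. \<forall>i\<ge>m. v i = 0}"

definition cform :: "nat \<Rightarrow> (nat \<Rightarrow> nat \<Rightarrow> gf3) \<Rightarrow> (nat \<Rightarrow> gf3) \<Rightarrow> (nat \<Rightarrow> gf3) \<Rightarrow> gf3" where
  "cform m G u v = (\<Sum>i<m. \<Sum>j<m. G i j * u i * v j)"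

definition unit :: "nat \<Rightarrow> nat \<Rightarrow> gf3" where
  "unit k = (\<lambda>i. if i = k then 1 else 0)"

lemma gf3_form_cform:
  assumes "\<And>i j. i < m \<Longrightarrow> j < m \<Longrightarrow> G i j = G j i"
  shows "gf3_form (cform m G)"
proof
  fix x y z :: "nat \<Rightarrow> gf3"
  have "cform m G x y = (\<Sum>j<m. \<Sum>i<m. G i j * x i * y j)"
    unfolding cform_def by (rule sum.swap)
  also have "\<dots> = cform m G y x"
    unfolding cform_def using assms by (intro sum.cong) (auto simp: mult.commute mult.left_commute)
  finally show "cform m G x y = cform m G y x" .
  show "cform m G (x + y) z = cform m G x z + cform m G y z"
    by (simp add: cform_def distrib_left distrib_right sum.distrib)
  show "x + x + x = 0" by (rule ext) (simp add: gf3_triple)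
qed

lemma sgrp_coords: "sgrp (coords m)"
  by (auto simp: sgrp_def coords_def)

lemma card_coords: "finite (coords m) \<and> card (coords m) = 3 ^ m"
proof (induction m)
  case 0
  have "coords 0 = {0}" by (auto simp: coords_def)
  then show ?case by simp
next
  case (Suc m)
  let ?f = "\<lambda>(c, v :: nat \<Rightarrow> gf3). v(m := c)"
  have "inj_on ?f (UNIV \<times> coords m)"
  proof (rule inj_onI, clarify)
    fix c d and u v :: "nat \<Rightarrow> gf3"
    assume uv: "u \<in> coords m" "v \<in> coords m" and eq: "u(m := c) = v(m := d)"
    have "c = d" using fun_cong[OF eq, of m] by simp
    moreover have "u i = v i" for i
      using fun_cong[OF eq, of i] uv by (cases "i = m") (auto simp: coords_def)
    ultimately show "c = d \<and> u = v" by auto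
  qed
  moreover have "?f ` (UNIV \<times> coords m) = coords (Suc m)"
  proof
    show "?f ` (UNIV \<times> coords m) \<subseteq> coords (Suc m)" by (auto simp: coords_def)
    show "coords (Suc m) \<subseteq> ?f ` (UNIV \<times> coords m)"
    proof
      fix v assume "v \<in> coords (Suc m)"
      then have "v(m := 0) \<in> coords m" by (auto simp: coords_def)
      moreover have "v = ?f (v m, v(m := 0))" by simp
      ultimately show "v \<in> ?f ` (UNIV \<times> coords m)" by blast
    qed
  qed
  ultimately have "bij_betw ?f (UNIV \<times> coords m) (coords (Suc m))" by (simp add: bij_betw_def)
  then show ?case using Suc bij_betw_same_card[of ?f] bij_betw_finite[of ?f]
    by (metis card_UNIV_gf3 card_cartesian_product finite finite_SigmaI power_Suc)
qed

lemma unit_in_coords: "k < m \<Longrightarrow> unit k \<in> coords m"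
  by (auto simp: unit_def coords_def)

lemma cform_unit: "k < m \<Longrightarrow> cform m G (unit k) v = (\<Sum>j<m. G k j * v j)"
  unfolding cform_def unit_def
  by (subst sum.remove[of _ k]) (auto intro!: sum.neutral)

text \<open>A radical vector is perpendicular to all unit vectors, hence in the kernel of the Gram
  matrix.\<close>

lemma nondeg_coords:
  assumes "gf3_form (cform m G)" "det (mat m m (\<lambda>(i, j). G i j)) \<noteq> 0"
  shows "gf3_form.nondeg (cform m G) (coords m)"
proof -
  interpret gf3_form "cform m G" by fact
  let ?M = "mat m m (\<lambda>(i, j). G i j)"
  have "u = 0" if u: "u \<in> coords m" "\<And>v. v \<in> coords m \<Longrightarrow> cform m G u v = 0" for u
  proof -
    have "(\<Sum>j<m. G i j * u j) = 0" if "i < m" for i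
      using u(2)[OF unit_in_coords[OF that]] cform_unit[OF that, of G u] by (simp add: sym)
    then have "?M *\<^sub>v vec m u = 0\<^sub>v m"
      by (intro eq_vecI) (auto simp: scalar_prod_def lessThan_atLeast0)
    then have "vec m u = 0\<^sub>v m"
      using assms(2) det_0_iff_vec_prod_zero[of ?M m] by (metis mat_carrier vec_carrier)
    then have "u i = 0" if "i < m" for i using that by (metis index_vec index_zero_vec(1))
    moreover have "u i = 0" if "\<not> i < m" for i using u(1) that by (simp add: coords_def)
    ultimately show ?thesis by (auto simp: fun_eq_iff)
  qed
  then show ?thesis using card_coords[of m] by (auto simp: nondeg_def sgrp_coords rad_def)
qed

text \<open>The change of basis P^T G P to the family is diagonal, and \<open>d\<close> is the
  determinant of P.\<close>

lemma det_orthogonal_family: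
  assumes "gf3_form (cform m G)" "length vs = m" "gf3_form.orthogonal (cform m G) vs"
  shows "\<exists>d. (\<Prod>v\<leftarrow>vs. cform m G v v) = d * d * det (mat m m (\<lambda>(i, j). G i j))"
proof -
  interpret gf3_form "cform m G" by fact
  let ?M = "mat m m (\<lambda>(i, j). G i j)" and ?P = "mat m m (\<lambda>(i, j). (vs ! j) i)"
  let ?D = "mat m m (\<lambda>(i, j). cform m G (vs ! i) (vs ! j))"
  have "transpose_mat ?P * ?M * ?P = ?D"
  proof (rule eq_matI)
    fix i j assume ij: "i < dim_row ?D" "j < dim_col ?D"
    have "(transpose_mat ?P * ?M * ?P) $$ (i, j)
        = (\<Sum>l<m. (\<Sum>k<m. (vs ! i) k * G k l) * (vs ! j) l)"
      using ij by (simp add: scalar_prod_def lessThan_atLeast0)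
    also have "\<dots> = (\<Sum>l<m. \<Sum>k<m. G k l * (vs ! i) k * (vs ! j) l)"
      by (simp add: sum_distrib_left mult.commute mult.left_commute)
    also have "\<dots> = cform m G (vs ! i) (vs ! j)"
      unfolding cform_def by (rule sum.swap)
    finally show "(transpose_mat ?P * ?M * ?P) $$ (i, j) = ?D $$ (i, j)" using ij by simp
  qed auto
  moreover have "det (transpose_mat ?P * ?M * ?P) = det ?P * det ?M * det ?P"
  proof -
    have c: "?P \<in> carrier_mat m m" "transpose_mat ?P \<in> carrier_mat m m" "?M \<in> carrier_mat m m"
      by auto
    show ?thesis
      by (simp only: det_mult[OF mult_carrier_mat[OF c(2,3)] c(1)] det_mult[OF c(2,3)] det_transpose[OF c(1)])
  qed
  moreover have "det ?D = (\<Prod>v\<leftarrow>vs. cform m G v v)"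
  proof -
    have "upper_triangular ?D"
      using orthogonal_nth[OF assms(3)] assms(2) by (auto simp: upper_triangular_def)
    then have "det ?D = prod_list (diag_mat ?D)" by (intro det_upper_triangular[of _ m]) auto
    moreover have "diag_mat ?D = map (\<lambda>v. cform m G v v) vs"
      using assms(2) by (intro nth_equalityI) (auto simp: diag_mat_def)
    ultimately show ?thesis by simp
  qed
  ultimately show ?thesis by (intro exI[of _ "det ?P"]) (simp add: mult.commute mult.left_commute)
qed

section \<open>The standard form of given discriminant\<close>

lemma prod_list_all_1: "(\<And>y. y \<in> set ys \<Longrightarrow> y = 1) \<Longrightarrow> prod_list ys = (1::'b::monoid_mult)"
  by (induction ys) auto

text \<open>The diagonal form (c,1,...,1). With \<open>c\<close> in the first place, the restriction
  to a shorter nonzero coordinate space has the same discriminant.\<close>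

definition std :: "gf3 \<Rightarrow> nat \<Rightarrow> nat \<Rightarrow> gf3" where
  "std c i j = (if i = j then if i = 0 then c else 1 else 0)"

lemma gf3_form_std: "gf3_form (cform N (std c))"
  by (rule gf3_form_cform) (auto simp: std_def)

lemma det_std: "det (mat (Suc m) (Suc m) (\<lambda>(i, j). std c i j)) = c"
proof -
  let ?M = "mat (Suc m) (Suc m) (\<lambda>(i, j). std c i j)"
  have "det ?M = prod_list (diag_mat ?M)"
    by (intro det_upper_triangular[of _ "Suc m"]) (auto simp: upper_triangular_def std_def)
  also have "diag_mat ?M = map (\<lambda>i. if i = 0 then c else 1) [0..<Suc m]"
    by (auto simp: diag_mat_def std_def)
  also have "prod_list \<dots> = c"
    unfolding upt_conv_Cons[OF zero_less_Suc] list.map by (auto intro!: prod_list_all_1)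
  finally show ?thesis .
qed

lemma cform_std:
  assumes "u \<in> coords m" "m \<le> N"
  shows "cform N (std c) u v = (\<Sum>i<m. (if i = 0 then c else 1) * u i * v i)"
proof -
  have "cform N (std c) u v = (\<Sum>i<N. (if i = 0 then c else 1) * u i * v i)"
    unfolding cform_def
  proof (rule sum.cong)
    fix i assume "i \<in> {..<N}"
    then show "(\<Sum>j<N. std c i j * u i * v j) = (if i = 0 then c else 1) * u i * v i"
      by (subst sum.remove[of _ i]) (auto simp: std_def intro!: sum.neutral)
  qed simp
  also have "\<dots> = (\<Sum>i<m. (if i = 0 then c else 1) * u i * v i)"
    using assms by (intro sum.mono_neutral_right) (auto simp: coords_def)
  finally show ?thesis .
qed

text \<open>In an orthogonal basis with norms 1 from index 1 on, the determinant forces the first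
  norm to be \<open>c\<close>, as nonzero squares are 1. Allowing \<open>N\<close> above
  \<open>m\<close> lets a single form serve two dimensions.\<close>

lemma isometry_from_std:
  assumes G: "gf3_form (cform m G)" and det: "det (mat m m (\<lambda>(i, j). G i j)) = c" "c \<noteq> 0"
    and m: "0 < m" "m \<le> N"
  shows "\<exists>L. inj_on L (coords m) \<and> L ` coords m = coords m \<and>
    (\<forall>u\<in>coords m. \<forall>v\<in>coords m. L (u + v) = L u + L v \<and> cform m G (L u) (L v) = cform N (std c) u v)"
proof -
  interpret G: gf3_form "cform m G" by fact
  have nd: "G.nondeg (coords m)" using nondeg_coords[OF G] det by simp
  obtain vs where vs: "length vs = m" "set vs \<subseteq> coords m" "G.orthogonal vs"
      "\<forall>i<m. cform m G (vs ! i) (vs ! i) \<noteq> 0 \<and> (0 < i \<longrightarrow> cform m G (vs ! i) (vs ! i) = 1)"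
    using G.exists_orthogonal_family[OF nd, of m] card_coords[of m] by auto
  have norm: "cform m G (vs ! i) (vs ! i) = (if i = 0 then c else 1)" if "i < m" for i
  proof (cases "i = 0")
    case True
    obtain v ws where vws: "vs = v # ws" using vs(1) m by (cases vs) auto
    have "(\<Prod>w\<leftarrow>ws. cform m G w w) = 1"
    proof (rule prod_list_all_1)
      fix y assume "y \<in> set (map (\<lambda>w. cform m G w w) ws)"
      then obtain k where "k < length ws" "y = cform m G (ws ! k) (ws ! k)"
        by (auto simp: in_set_conv_nth)
      then show "y = 1" using vs(1,4) vws by (auto dest!: spec[of _ "Suc k"])
    qed
    then have "cform m G v v = (\<Prod>w\<leftarrow>vs. cform m G w w)" by (simp add: vws)
    also obtain d where "\<dots> = d * d * c" using det_orthogonal_family[OF G vs(1,3)] det by auto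
    finally have *: "cform m G v v = d * d * c" .
    moreover have "cform m G v v \<noteq> 0" using vs(4) m vws by fastforce
    ultimately have "d \<noteq> 0" by auto
    then show ?thesis using * True by (simp add: gf3_square vws)
  qed (use vs(4) that in auto)
  define L where "L u = (\<Sum>j<m. scl (u j) (vs ! j))" for u :: "nat \<Rightarrow> gf3"
  have L_in: "L u \<in> coords m" for u
  proof -
    have "(\<Sum>j\<in>J. scl (u j) (vs ! j)) \<in> coords m" if "J \<subseteq> {..<m}" for J
      using that
    proof (induction J rule: infinite_finite_induct)
      case (insert j J)
      then have "(\<Sum>j\<in>J. scl (u j) (vs ! j)) \<in> coords m" "vs ! j \<in> coords m"
        using vs(1,2) nth_mem by auto
      then show ?case unfolding sum.insert[OF insert.hyps]
        by (intro sgrp_add[OF sgrp_coords] sgrp_scl[OF sgrp_coords])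
    qed (auto simp: sgrp_0[OF sgrp_coords])
    then show ?thesis by (simp add: L_def)
  qed
  have L_add: "L (u + v) = L u + L v" for u v
    by (simp add: L_def G.scl_add sum.distrib)
  have L_B: "cform m G (L u) (L v) = cform N (std c) u v" if "u \<in> coords m" for u v
  proof -
    have "cform m G (L u) (L v) = (\<Sum>i<m. \<Sum>j<m. u i * (v j * cform m G (vs ! i) (vs ! j)))"
      by (simp only: L_def G.sum_left) (simp add: G.sum_right sum_distrib_left mult.left_commute)
    also have "\<dots> = (\<Sum>i<m. (if i = 0 then c else 1) * u i * v i)"
    proof (rule sum.cong)
      fix i assume i: "i \<in> {..<m}"
      have "(\<Sum>j<m. u i * (v j * cform m G (vs ! i) (vs ! j))) = u i * (v i * cform m G (vs ! i) (vs ! i))"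
        using i G.orthogonal_nth[OF vs(3)] vs(1)
        by (subst sum.remove[of _ i]) (auto intro!: sum.neutral)
      then show "(\<Sum>j<m. u i * (v j * cform m G (vs ! i) (vs ! j))) = (if i = 0 then c else 1) * u i * v i"
        using norm i by simp
    qed simp
    finally show ?thesis using cform_std[OF that m(2)] by simp
  qed
  have inj: "inj_on L (coords m)"
  proof
    fix u v assume uv: "u \<in> coords m" "v \<in> coords m" "L u = L v"
    show "u = v"
    proof
      fix i
      show "u i = v i"
      proof (cases "i < m")
        case True
        have "cform N (std c) (unit i) u = cform N (std c) (unit i) v"
          using L_B[OF unit_in_coords[OF True]] uv(3) by metis
        moreover have "cform N (std c) (unit i) w = (if i = 0 then c else 1) * w i" for w
          unfolding cform_std[OF unit_in_coords[OF True] m(2)]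
          using True by (subst sum.remove[of _ i]) (auto simp: unit_def intro!: sum.neutral)
        ultimately show ?thesis using det(2) by (auto split: if_splits)
      next
        case False
        then show ?thesis using uv by (simp add: coords_def)
      qed
    qed
  qed
  have "L ` coords m = coords m"
    using endo_inj_surj[OF _ _ inj] card_coords[of m] L_in by blast
  then show ?thesis using inj L_add L_B by blast
qed

section \<open>Residues modulo 3 and the given graphs\<close>

definition lift :: "gf3 \<Rightarrow> int" where
  "lift c = (if c = 0 then 0 else if c = 1 then 1 else 2)"

lemma of_int_lift: "of_int (lift c) = c"
  by (cases c rule: gf3_exhaust) (simp_all add: lift_def)

lemma of_int_mod_3: "(of_int (k mod 3) :: gf3) = of_int k"
proof -
  have "of_int k = (of_int (3 * (k div 3) + k mod 3) :: gf3)" by simp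
  also have "\<dots> = of_int (k mod 3)" unfolding of_int_add of_int_mult by simp
  finally show ?thesis by simp
qed

lemma of_int_gf3_eq_iff: "(of_int k = (of_int l :: gf3)) \<longleftrightarrow> k mod 3 = l mod 3"
proof
  assume eq: "(of_int k :: gf3) = of_int l"
  have lft: "lift (of_int (j mod 3)) = j mod 3" for j :: int
  proof -
    have "j mod 3 = 0 \<or> j mod 3 = 1 \<or> j mod 3 = 2" by auto
    then show ?thesis by (auto simp: lift_def)
  qed
  then show "k mod 3 = l mod 3" using eq by (metis of_int_mod_3)
next
  assume "k mod 3 = l mod 3"
  then show "(of_int k :: gf3) = of_int l" by (metis of_int_mod_3)
qed

lemma lift_neg: "lift (- c) = (- lift c) mod 3"
  by (cases c rule: gf3_exhaust) (simp_all add: lift_def)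

lemma inj_lift: "lift c = lift d \<longleftrightarrow> c = d"
  by (metis of_int_lift)

lemma vecs3_eq: "vecs3 m = (\<lambda>u. lift \<circ> u) ` coords m"
proof
  show "(\<lambda>u. lift \<circ> u) ` coords m \<subseteq> vecs3 m" by (auto simp: vecs3_def coords_def lift_def split: if_splits)
  show "vecs3 m \<subseteq> (\<lambda>u. lift \<circ> u) ` coords m"
  proof
    fix v assume v: "v \<in> vecs3 m"
    have "v i = lift (of_int (v i))" for i
    proof -
      have "v i = 0 \<or> v i = 1 \<or> v i = 2" using v by (cases "i < m") (auto simp: vecs3_def)
      then show ?thesis by (auto simp: lift_def)
    qed
    then have "v = lift \<circ> (\<lambda>i. of_int (v i))" by auto
    moreover have "(\<lambda>i. of_int (v i)) \<in> coords m" using v by (auto simp: vecs3_def coords_def)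
    ultimately show "v \<in> (\<lambda>u. lift \<circ> u) ` coords m" by blast
  qed
qed

lemma form3_lift:
  "form3 m A (lift \<circ> u) (lift \<circ> v) mod 3 = k mod 3 \<longleftrightarrow> cform m (\<lambda>i j. of_int (A i j)) u v = of_int k"
  unfolding of_int_gf3_eq_iff[symmetric]
  by (simp add: form3_def of_int_mod_3 cform_def of_int_lift)

lemma neg3_lift: "neg3 (lift \<circ> u) = lift \<circ> (- u)"
  by (auto simp: neg3_def lift_neg)

text \<open>Perpendicularity is insensitive to the signs of representatives, so the existential in
  \<open>SigmaE\<close> may be tested on any pair.\<close>

lemma models_Sigma:
  assumes "gf3_form (cform m (\<lambda>i j. of_int (A i j)))"
  shows "gf3_form.models (cform m (\<lambda>i j. of_int (A i j))) (coords m)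
    (\<lambda>u. {lift \<circ> u, lift \<circ> (- u)}) (SigmaV m A) (SigmaE m A)"
proof -
  interpret gf3_form "cform m (\<lambda>i j. of_int (A i j))" by fact
  let ?f = "\<lambda>u. {lift \<circ> u, lift \<circ> (- u)}"
  have f0: "form3 m A (lift \<circ> u) (lift \<circ> v) = 0 \<longleftrightarrow> cform m (\<lambda>i j. of_int (A i j)) u v = 0" for u v
    using form3_lift[of m A u v 0] by (simp add: form3_def)
  have f1: "form3 m A (lift \<circ> u) (lift \<circ> v) = 1 \<longleftrightarrow> cform m (\<lambda>i j. of_int (A i j)) u v = 1" for u v
    using form3_lift[of m A u v 1] by (simp add: form3_def)
  have inj: "lift \<circ> u = lift \<circ> v \<longleftrightarrow> u = v" for u v
    by (auto simp: fun_eq_iff inj_lift)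
  have img: "?f ` plus (coords m) = SigmaV m A"
    unfolding SigmaV_def vecs3_eq by (auto simp: in_plus f1 neg3_lift)
  have "?f u = ?f v \<longleftrightarrow> u = v \<or> u = - v" for u v
    by (auto simp: doubleton_eq_iff inj)
  moreover have "SigmaE m A (?f u) (?f v) \<longleftrightarrow> cform m (\<lambda>i j. of_int (A i j)) u v = 0"
    if "u \<in> plus (coords m)" "v \<in> plus (coords m)" for u v
    using img that unfolding SigmaE_def by (auto simp: f0)
  ultimately show ?thesis using img unfolding models_def by blast
qed

text \<open>Forms of equal dimension and discriminant are isometric, so every admissible Gram matrix
  may be replaced by a restriction of the standard form.\<close>

lemma std_models_Sigma:
  assumes eps: "eps \<in> {1, -1}" and A: "gram3 m eps A" and m: "0 < m" "m \<le> N"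
  shows "\<exists>f. gf3_form.models (cform N (std (of_int eps))) (coords m) f (SigmaV m A) (SigmaE m A)"
proof -
  let ?G = "\<lambda>i j. of_int (A i j) :: gf3" and ?c = "of_int eps :: gf3"
  have G: "gf3_form (cform m ?G)"
    using A by (intro gf3_form_cform) (auto simp: gram3_def of_int_gf3_eq_iff)
  interpret S: gf3_form "cform N (std ?c)" by (rule gf3_form_std)
  have "mat m m (\<lambda>(i, j). ?G i j) = map_mat of_int (mat m m (\<lambda>(i, j). A i j))"
    by (intro eq_matI) auto
  then have "det (mat m m (\<lambda>(i, j). ?G i j)) = of_int (det (mat m m (\<lambda>(i, j). A i j)))"
    by (simp add: of_int_hom.hom_det)
  also have "\<dots> = ?c" using A by (simp add: gram3_def of_int_gf3_eq_iff)
  finally have det: "det (mat m m (\<lambda>(i, j). ?G i j)) = ?c" .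
  have "?c \<noteq> 0" using eps by auto
  from isometry_from_std[OF G det this m] obtain L where L: "inj_on L (coords m) \<and>
    L ` coords m = coords m \<and> (\<forall>u\<in>coords m. \<forall>v\<in>coords m. L (u + v) = L u + L v \<and>
      cform m ?G (L u) (L v) = cform N (std ?c) u v)"
    by (elim exE)
  show ?thesis
    by (rule exI, rule S.models_comp[OF G models_Sigma[OF G] sgrp_coords, of L]) (use L in auto)
qed

section \<open>Models and graph isomorphisms\<close>

context gf3_form
begin

lemma models_graph_iso:
  assumes g: "graph_iso W R W' R'" and f: "models U f W' R'"
  shows "\<exists>f'. models U f' W R"
proof -
  obtain h where h: "bij_betw h W W'" "\<forall>u\<in>W. \<forall>v\<in>W. R u v \<longleftrightarrow> R' (h u) (h v)"
    using g by (auto simp: graph_iso_def)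
  let ?k = "inv_into W h"
  have k: "bij_betw ?k W' W" "\<And>w. w \<in> W' \<Longrightarrow> ?k w \<in> W \<and> h (?k w) = w"
    using h(1) bij_betw_inv_into[OF h(1)]
    by (auto simp: bij_betw_inv_into_right inv_into_into bij_betw_def f_inv_into_f)
  have "(?k \<circ> f) ` plus U = W"
    using models_image[OF f] k(1) by (simp only: image_comp[symmetric] bij_betw_def)
  moreover have "?k (f u) = ?k (f v) \<longleftrightarrow> f u = f v" if "u \<in> plus U" "v \<in> plus U" for u v
    using models_in[OF f] that k(2) by metis
  moreover have "R (?k (f u)) (?k (f v)) \<longleftrightarrow> R' (f u) (f v)" if "u \<in> plus U" "v \<in> plus U" for u v
    using models_in[OF f] that k(2) h(2) by metis
  ultimately have "models U (?k \<circ> f) W R" using f by (simp add: models_def)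
  then show ?thesis by blast
qed

lemma models_imp_graph_iso:
  assumes f: "models U f W R" and g: "models U g W' R'"
  shows "graph_iso W R W' R'"
proof -
  let ?A = "plus U"
  let ?h = "\<lambda>w. g (inv_into ?A f w)"
  have i: "inv_into ?A f w \<in> ?A" "f (inv_into ?A f w) = w" if "w \<in> W" for w
    using that models_image[OF f] by (auto simp: inv_into_into f_inv_into_f)
  have "bij_betw ?h W W'"
  proof (rule bij_betwI')
    fix x y assume xy: "x \<in> W" "y \<in> W"
    show "?h x = ?h y \<longleftrightarrow> x = y"
      using models_eq_iff[OF g] models_eq_iff[OF f] i[OF xy(1)] i[OF xy(2)] by metis
  next
    fix x assume "x \<in> W"
    then show "?h x \<in> W'" using i models_in[OF g] by blast
  next
    fix y assume "y \<in> W'"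
    then obtain u where u: "u \<in> ?A" "y = g u" using models_image[OF g] by blast
    have "f u \<in> W" using models_in[OF f u(1)] .
    then have "?h (f u) = y" using i[of "f u"] u models_eq_iff[OF g] models_eq_iff[OF f] by metis
    then show "\<exists>x\<in>W. y = ?h x" using \<open>f u \<in> W\<close> by blast
  qed
  moreover have "R x y \<longleftrightarrow> R' (?h x) (?h y)" if "x \<in> W" "y \<in> W" for x y
    using models_adj_iff[OF f] models_adj_iff[OF g] i[OF that(1)] i[OF that(2)] by metis
  ultimately show ?thesis unfolding graph_iso_def by blast
qed

end

theorem mainTheorem1:
  fixes V :: "'a set" and E :: "'a \<Rightarrow> 'a \<Rightarrow> bool"
    and eps :: int and n :: nat and A B :: "nat \<Rightarrow> nat \<Rightarrow> int"
  assumes "eps \<in> {1, -1}"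
    and "eps = 1 \<Longrightarrow> n \<ge> 6"
    and "eps = -1 \<Longrightarrow> n \<ge> 7"
    and "gram3 n eps A"
    and "gram3 (n + 1) eps B"
    and "simple_graph V E"
    and "connected_graph V E"
    and "\<forall>v\<in>V. graph_iso (nbhd V E v) (induced (nbhd V E v) E) (SigmaV n A) (SigmaE n A)"
  shows "graph_iso V E (SigmaV (n + 1) B) (SigmaE (n + 1) B)"
proof -
  define c where "c = (of_int eps :: gf3)"
  have c0: "c \<noteq> 0" using assms(1) by (auto simp: c_def)
  have n6: "6 \<le> n" using assms(1-3) by auto
  let ?F = "cform (n + 1) (std c)"
  interpret S: gf3_form ?F by (rule gf3_form_std)
  \<comment> \<open>The perpendicular of the last unit vector is \<open>coords n\<close>, with the
    same discriminant, so it models the given neighbourhoods.\<close>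
  let ?T = "coords (n + 1)" and ?e = "unit n"
  have nd: "S.nondeg ?T" using nondeg_coords[OF gf3_form_std] det_std[of n c] c0 by simp
  have Be: "?F u ?e = u n" for u
    unfolding S.sym[of u] using cform_unit[of n "n + 1" "std c" u] n6
    by (simp add: std_def if_distrib[of "\<lambda>x. x * _"] sum.delta cong: if_cong)
  have e: "?e \<in> S.plus ?T"
    unfolding S.in_plus Be by (auto simp: unit_def coords_def)
  have Te: "S.perp ?e ?T = coords n"
  proof -
    have "(\<forall>i\<ge>n + 1. v i = 0) \<and> v n = 0 \<longleftrightarrow> (\<forall>i\<ge>n. v i = 0)" for v :: "nat \<Rightarrow> gf3"
      by (metis Suc_eq_plus1 Suc_leI le_add1 le_neq_implies_less le_refl le_trans)
    then show ?thesis unfolding S.perp_def Be coords_def by simp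
  qed
  have "(3::nat) ^ 7 \<le> 3 ^ (n + 1)" using n6 by (intro power_increasing) auto
  then have card: "2187 \<le> card ?T" using card_coords[of "n + 1"] by simp
  \<comment> \<open>Fewer than 3^8 elements means \<open>n = 6\<close> and thus
    \<open>eps = 1\<close>; the family would then make -1 a square.\<close>
  have no_family: False
    if small: "card ?T < 6561" and vs: "length vs = 7" "S.orthogonal vs" "(\<Prod>v\<leftarrow>vs. ?F v v) = - 1" for vs
  proof -
    have "\<not> 7 \<le> n"
    proof
      assume "7 \<le> n"
      then have "(3::nat) ^ 8 \<le> 3 ^ (n + 1)" by (intro power_increasing) auto
      then show False using small card_coords[of "n + 1"] by simp
    qed
    then have "n = 6" "c = 1" using n6 assms(1,3) by (auto simp: c_def)
    then obtain d where "- 1 = d * d * (1::gf3)"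
      using det_orthogonal_family[OF gf3_form_std, of vs "n + 1" c] vs det_std[of n c] by auto
    then show False by (cases d rule: gf3_exhaust) auto
  qed
  interpret local_sigma ?F ?T ?e V E
  proof
    fix x y p
    assume "x \<in> S.plus (S.perp ?e ?T)" "y \<in> S.plus (S.perp ?e ?T)" "?F x y \<noteq> 0"
      "p \<in> S.perp y (S.perp x (S.perp ?e ?T))" "?F p p = 0" "x \<noteq> y" "x \<noteq> - y"
    then show "\<exists>t. t \<in> S.plus (S.perp p (S.perp y (S.perp x (S.perp ?e ?T))))"
      using S.common_plus_or_family[OF nd card e] no_family by blast
  next
    fix v assume v: "v \<in> V"
    obtain f where f: "S.models (coords n) f (SigmaV n A) (SigmaE n A)"
      using std_models_Sigma[OF assms(1,4), of "n + 1"] n6 by (auto simp: c_def)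
    obtain f' where "S.models (coords n) f' (nbhd V E v) (induced (nbhd V E v) E)"
      using S.models_graph_iso[OF _ f] assms(8) v by blast
    then have "S.models (coords n) f' (nbhd V E v) E"
      unfolding S.models_def induced_def by blast
    then show "\<exists>f. S.models (S.perp ?e ?T) f (nbhd V E v) E" unfolding Te by blast
  qed (use nd card e assms(6,7) in auto)
  obtain v0 where v0: "v0 \<in> V" using assms(7) by (auto simp: connected_graph_def)
  obtain eta where "S.models (S.perp ?e ?T) eta (nbhd V E v0) E" using loc v0 by blast
  then interpret base_chart ?F ?T ?e V E v0 eta using v0 by unfold_locales
  obtain F where F: "S.models ?T F V E" using models_T by blast
  obtain g where g: "S.models ?T g (SigmaV (n + 1) B) (SigmaE (n + 1) B)"
    using std_models_Sigma[OF assms(1,5), of "n + 1"] by (auto simp: c_def)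
  show ?thesis by (rule S.models_imp_graph_iso[OF F g])
qed

end
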